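(* Helices correspond to $L^2(\mathbb{R})$ linearly stable stationary solutions of $$\tau_t = D_s\big(\tau^{-1/2}-\tau^{3/2}+D_s^2(\tau^{-1/2})\big).$$ That is, every positive constant $\tau\equiv\tau_0$ is an $L^2(\mathbb{R})$ linearly stable stationary solution of this equation.
   Context: $D_s=\partial/\partial s$. The equation is the torsion evolution for space curves with constant curvature $1$ and positive torsion; helices are the curves with constant torsion $\tau_0>0$. The linearization of the equation at a stationary solution $\tau_0$ is the linear PDE for $w(s,t)$ obtained by substituting $\tau=\tau_0+\epsilon w$, dividing by $\epsilon$ and letting $\epsilon\to0$ (the Gateaux derivative of the right-hand side at $\tau_0$ in direction $w$). A stationary solution of a nonlinear PDE is called $L^2(\mathbb{R})$ linearly stable if $w=0$ is a stable solution of the linearized PDE in the $L^2(\mathbb{R})$ norm: for every $\epsilon>0$ there is $\delta>0$ such that if $w_0\in L^2(\mathbb{R})$ and $\|w_0\|_2<\delta$, then the (weak) solution $w$ of the linearized PDE with $w(\cdot,0)=w_0$ satisfies $\|w(t)\|_2<\epsilon$ for all $t\ge0$. *)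

theory Defs
  imports "HOL-Analysis.Analysis"
begin

definition smooth_fun :: "(real \<Rightarrow> real) \<Rightarrow> bool" where
  "smooth_fun f \<longleftrightarrow> (\<forall>n x. (deriv ^^ n) f differentiable (at x))"

definition test_fun :: "(real \<Rightarrow> real) \<Rightarrow> bool" where
  "test_fun \<phi> \<longleftrightarrow> smooth_fun \<phi> \<and> compact (closure {s. \<phi> s \<noteq> 0})"

text \<open>Elements of L2 are represented by Borel functions; equality in L2 is equality
  almost everywhere.\<close>

definition in_L2 :: "(real \<Rightarrow> real) \<Rightarrow> bool" where
  "in_L2 f \<longleftrightarrow> f \<in> borel_measurable lborel \<and> integrable lborel (\<lambda>s. (f s)\<^sup>2)"

definition L2_norm :: "(real \<Rightarrow> real) \<Rightarrow> real" where
  "L2_norm f = sqrt (LINT s|lborel. (f s)\<^sup>2)"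

text \<open>A spatial operator \<open>F\<close> stands for the right-hand side of an evolution equation
  \<open>u_t = F u\<close>. Functions of time and space are curried, with time as the first argument.\<close>

type_synonym spatial_op = "(real \<Rightarrow> real) \<Rightarrow> real \<Rightarrow> real"

definition torsion_rhs :: spatial_op where
  "torsion_rhs \<tau> = deriv (\<lambda>s. \<tau> s powr (-1/2) - \<tau> s powr (3/2)
                              + (deriv ^^ 2) (\<lambda>r. \<tau> r powr (-1/2)) s)"

text \<open>Smoothness and positivity are part of being a solution: they make the library's
  total functions \<open>deriv\<close> and \<open>powr\<close> in the right-hand side meaningful.\<close>

definition positive_solution :: "spatial_op \<Rightarrow> (real \<Rightarrow> real \<Rightarrow> real) \<Rightarrow> bool" where
  "positive_solution F u \<longleftrightarrow>
     (\<forall>t\<ge>0. smooth_fun (u t) \<and> (\<forall>s. 0 < u t s) \<and>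
        (\<forall>s. ((\<lambda>r. u r s) has_real_derivative F (u t) s) (at t within {0..})))"

definition stationary_solution :: "spatial_op \<Rightarrow> (real \<Rightarrow> real) \<Rightarrow> bool" where
  "stationary_solution F \<tau> \<longleftrightarrow> positive_solution F (\<lambda>t. \<tau>)"

text \<open>\<open>A\<close> is the Gateaux derivative of \<open>F\<close> at \<open>\<tau>\<close>. It is determined on smooth directions,
  and its values elsewhere are never used.\<close>

definition is_linearization :: "spatial_op \<Rightarrow> (real \<Rightarrow> real) \<Rightarrow> spatial_op \<Rightarrow> bool" where
  "is_linearization F \<tau> A \<longleftrightarrow>
     (\<forall>w. smooth_fun w \<longrightarrow>
        (\<forall>s. ((\<lambda>\<epsilon>. (F (\<lambda>x. \<tau> x + \<epsilon> * w x) s - F \<tau> s) / \<epsilon>) \<longlongrightarrow> A w s) (at 0)))"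

definition formal_adjoint :: "spatial_op \<Rightarrow> spatial_op \<Rightarrow> bool" where
  "formal_adjoint A B \<longleftrightarrow>
     (\<forall>\<phi>. test_fun \<phi> \<longrightarrow> test_fun (B \<phi>) \<and>
        (\<forall>f. test_fun f \<longrightarrow>
           integrable lborel (\<lambda>s. A f s * \<phi> s) \<and>
           (LINT s|lborel. A f s * \<phi> s) = (LINT s|lborel. f s * B \<phi> s)))"

text \<open>Weak solutions of \<open>w_t = A w\<close>, \<open>w(0) = w0\<close> in \<open>C([0,\<infinity>); L2)\<close>. The formal adjoint is
  unique on test functions, so the existential quantifier over \<open>B\<close> involves no choice.\<close>

definition weak_solution ::
  "spatial_op \<Rightarrow> (real \<Rightarrow> real) \<Rightarrow> (real \<Rightarrow> real \<Rightarrow> real) \<Rightarrow> bool" where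
  "weak_solution A w0 w \<longleftrightarrow>
     (\<forall>t\<ge>0. in_L2 (w t)) \<and>
     (\<forall>t\<ge>0. ((\<lambda>r. L2_norm (\<lambda>s. w r s - w t s)) \<longlongrightarrow> 0) (at t within {0..})) \<and>
     (AE s in lborel. w 0 s = w0 s) \<and>
     (\<exists>B. formal_adjoint A B \<and>
        (\<forall>\<phi>. test_fun \<phi> \<longrightarrow>
           (\<forall>t\<ge>0. ((\<lambda>r. LINT s|lborel. w r s * \<phi> s) has_real_derivative
                    (LINT s|lborel. w t s * B \<phi> s)) (at t within {0..}))))"

text \<open>Stability of the zero solution of \<open>w_t = A w\<close>. Speaking of the weak solution with given
  initial data presupposes its existence and uniqueness; both are asserted here.\<close>

definition L2_stable_zero :: "spatial_op \<Rightarrow> bool" where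
  "L2_stable_zero A \<longleftrightarrow>
     (\<forall>\<epsilon>>0. \<exists>\<delta>>0. \<forall>w0. in_L2 w0 \<and> L2_norm w0 < \<delta> \<longrightarrow>
        (\<exists>w. weak_solution A w0 w \<and>
             (\<forall>v. weak_solution A w0 v \<longrightarrow> (\<forall>t\<ge>0. AE s in lborel. v t s = w t s)) \<and>
             (\<forall>t\<ge>0. L2_norm (w t) < \<epsilon>)))"

definition L2_linearly_stable :: "spatial_op \<Rightarrow> (real \<Rightarrow> real) \<Rightarrow> bool" where
  "L2_linearly_stable F \<tau> \<longleftrightarrow> (\<exists>A. is_linearization F \<tau> A \<and> L2_stable_zero A)"

end

theory Submission
  imports Defs
begin

text \<open>The linearization at a constant \<open>c\<close> is \<open>w\<^sub>t = - a w\<^sub>s - b w\<^sub>s\<^sub>s\<^sub>s\<close> with constant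
  coefficients, a skew-symmetric operator, so its solution operators are isometries of L2 and
  stability holds with \<open>\<delta> = \<epsilon>\<close>. To construct them, replace the operator by finite differences
  \<open>A\<^sub>n\<close>: these are bounded, skew and commute with each other. Their exponentials are isometries, and
  \<open>exp (t A\<^sub>n) z\<close> is a Cauchy sequence for test functions \<open>z\<close> because its members differ by at most
  \<open>\<bar>t\<bar>\<close> times the distance of \<open>A\<^sub>m z\<close> and \<open>A\<^sub>n z\<close>; by density of the test functions it converges on
  all of L2. For uniqueness, a weak solution is tested against the backward evolution
  \<open>exp ((s - t) A\<^sub>n) z\<close>.\<close>

section \<open>Exponentials of bounded operators\<close>

text \<open>Three obstacles shape the proof. The limit operator is unbounded and meaningful only on
  test functions, so the exponential series cannot be applied to it: every identity is proved for
  the bounded \<open>A n\<close>, carried to a dense set by a limit, and extended by isometry. In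
  the uniqueness argument the exact backward flow of a test function need not be a test function, so
  a weak solution cannot be tested against it. Polynomials in \<open>A n\<close> applied to a test
  function are finite combinations of its translates and are admissible; the price is the defect
  \<open>A n z - L z\<close>, which vanishes in the limit. Finally, a perturbation
  \<open>c + \<epsilon> * w x\<close> by an unbounded smooth \<open>w\<close> may fail to be
  positive at some \<open>x\<close> however small \<open>\<epsilon>\<close> is, so the linearization
  is computed at a single point \<open>s\<close>, using positivity near that point only. The
  coefficients \<open>a\<close> and \<open>b\<close> come from differentiating the powers of the
  torsion at \<open>c\<close>; skewness, and with it stability, holds for any real \<open>a\<close>
  and \<open>b\<close>.\<close>

lemma has_vector_derivative_uniform_limit:
  fixes f :: "nat \<Rightarrow> real \<Rightarrow> 'b::banach"
  assumes "convex S"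
    and der: "\<And>n t. t \<in> S \<Longrightarrow> (f n has_vector_derivative f' n t) (at t within S)"
    and unif: "uniform_limit S f' g' sequentially"
    and lim: "\<And>t. t \<in> S \<Longrightarrow> (\<lambda>n. f n t) \<longlonglongrightarrow> g t"
    and "t \<in> S"
  shows "(g has_vector_derivative g' t) (at t within S)"
proof -
  have "\<exists>h. \<forall>x\<in>S. (\<lambda>n. f n x) \<longlonglongrightarrow> h x \<and>
      (h has_derivative (\<lambda>r. r *\<^sub>R g' x)) (at x within S)"
  proof (rule has_derivative_sequence)
    show "(f n has_derivative (\<lambda>r. r *\<^sub>R f' n x)) (at x within S)" if "x \<in> S" for n x
      using der[OF that] by (simp add: has_vector_derivative_def)
    show "\<forall>\<^sub>F n in sequentially. \<forall>x\<in>S. \<forall>h. norm (h *\<^sub>R f' n x - h *\<^sub>R g' x) \<le> e * norm h"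
      if "e > 0" for e
      using uniform_limitD[OF unif that]
    proof eventually_elim
      case (elim n)
      have "norm (h *\<^sub>R f' n x - h *\<^sub>R g' x) \<le> e * norm h" if "x \<in> S" for x and h :: real
      proof -
        have "norm (h *\<^sub>R f' n x - h *\<^sub>R g' x) = norm (f' n x - g' x) * norm h"
          by (simp flip: scaleR_diff_right)
        also have "\<dots> \<le> e * norm h"
          using elim that by (intro mult_right_mono) (auto simp: dist_norm less_imp_le)
        finally show ?thesis .
      qed
      then show ?case by blast
    qed
  qed (use assms in auto)
  then obtain h where h: "\<And>x. x \<in> S \<Longrightarrow> (\<lambda>n. f n x) \<longlonglongrightarrow> h x"
      "\<And>x. x \<in> S \<Longrightarrow> (h has_vector_derivative g' x) (at x within S)"
    by (auto simp: has_vector_derivative_def)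
  have "h x = g x" if "x \<in> S" for x
    using LIMSEQ_unique h(1) lim that by blast
  then show ?thesis
    using h(2)[OF \<open>t \<in> S\<close>] \<open>t \<in> S\<close> has_vector_derivative_transform by metis
qed

text \<open>The partial sums get a name of their own because they stay in every subspace invariant
  under \<open>A\<close>, whereas the limit \<open>op_exp\<close> may leave it.\<close>

definition exp_sum :: "('a::real_normed_vector \<Rightarrow> 'a) \<Rightarrow> nat \<Rightarrow> real \<Rightarrow> 'a \<Rightarrow> 'a" where
  "exp_sum A n t x = (\<Sum>k<n. (t ^ k / fact k) *\<^sub>R (A ^^ k) x)"

definition op_exp :: "('a::real_normed_vector \<Rightarrow> 'a) \<Rightarrow> real \<Rightarrow> 'a \<Rightarrow> 'a" where
  "op_exp A t x = (\<Sum>k. (t ^ k / fact k) *\<^sub>R (A ^^ k) x)"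

context
  fixes A :: "'a::banach \<Rightarrow> 'a"
  assumes A: "bounded_linear A"
begin

lemma bounded_linear_funpow: "bounded_linear (A ^^ k)"
proof (induction k)
  case (Suc k)
  then show ?case using bounded_linear_compose[OF A] by (simp add: o_def)
qed (simp add: id_def bounded_linear_ident)

lemma norm_funpow_le: "norm ((A ^^ k) x) \<le> onorm A ^ k * norm x"
proof (induction k)
  case (Suc k)
  have "norm ((A ^^ Suc k) x) \<le> onorm A * norm ((A ^^ k) x)"
    using onorm[OF A] by simp
  also have "\<dots> \<le> onorm A * (onorm A ^ k * norm x)"
    using Suc onorm_pos_le[OF A] by (rule mult_left_mono)
  finally show ?case by (simp add: mult.assoc)
qed simp

text \<open>The exponential series of \<open>onorm A\<close> times the absolute value of
  \<open>T\<close> is a majorant. Uniformity on bounded intervals is what termwise differentiation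
  requires.\<close>

lemma exp_sum_uniform_limit:
  "uniform_limit {-T..T} (\<lambda>n t. exp_sum A n t x) (\<lambda>t. op_exp A t x) sequentially"
  unfolding exp_sum_def op_exp_def
proof (rule Weierstrass_m_test)
  show "norm ((t ^ k / fact k) *\<^sub>R (A ^^ k) x) \<le> (inverse (fact k) * (\<bar>T\<bar> * onorm A) ^ k) * norm x"
    if "t \<in> {-T..T}" for k t
  proof -
    have "\<bar>t\<bar> ^ k * norm ((A ^^ k) x) \<le> \<bar>T\<bar> ^ k * (onorm A ^ k * norm x)"
      using that by (intro mult_mono power_mono norm_funpow_le) auto
    then show ?thesis
      by (simp add: power_abs power_mult_distrib field_simps)
  qed
  show "summable (\<lambda>k. (inverse (fact k) * (\<bar>T\<bar> * onorm A) ^ k) * norm x)"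
    by (intro summable_mult2 summable_exp)
qed

lemma exp_sum_tendsto: "(\<lambda>n. exp_sum A n t x) \<longlonglongrightarrow> op_exp A t x"
proof -
  have "t \<in> {- \<bar>t\<bar>..\<bar>t\<bar>}"
    by (auto simp: abs_if)
  then show ?thesis
    by (rule tendsto_uniform_limitI[OF exp_sum_uniform_limit])
qed

lemma exp_sum_commute:
  assumes B: "bounded_linear B" and comm: "\<And>x. B (A x) = A (B x)"
  shows "B (exp_sum A n t x) = exp_sum A n t (B x)"
proof -
  interpret B: bounded_linear B by fact
  have "B ((A ^^ k) x) = (A ^^ k) (B x)" for k
    by (induction k) (auto simp: comm)
  then show ?thesis
    by (simp add: exp_sum_def B.sum B.scaleR)
qed

lemma op_exp_commute:
  assumes B: "bounded_linear B" and comm: "\<And>x. B (A x) = A (B x)"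
  shows "B (op_exp A t x) = op_exp A t (B x)"
proof (rule LIMSEQ_unique)
  show "(\<lambda>n. B (exp_sum A n t x)) \<longlonglongrightarrow> B (op_exp A t x)"
    using bounded_linear.tendsto[OF B exp_sum_tendsto] .
  show "(\<lambda>n. B (exp_sum A n t x)) \<longlonglongrightarrow> op_exp A t (B x)"
    using exp_sum_tendsto by (simp add: exp_sum_commute[OF assms])
qed

lemma op_exp_diff: "op_exp A t (x - y) = op_exp A t x - op_exp A t y"
proof (rule LIMSEQ_unique[OF exp_sum_tendsto])
  have "exp_sum A n t (x - y) = exp_sum A n t x - exp_sum A n t y" for n
    by (simp add: exp_sum_def linear_diff[OF bounded_linear.linear[OF bounded_linear_funpow]] scaleR_diff_right
        sum_subtractf)
  then show "(\<lambda>n. exp_sum A n t (x - y)) \<longlonglongrightarrow> op_exp A t x - op_exp A t y"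
    using tendsto_diff[OF exp_sum_tendsto exp_sum_tendsto] by simp
qed

lemma op_exp_0 [simp]: "op_exp A 0 x = x"
proof -
  have "(\<lambda>k. (0 ^ k / fact k) *\<^sub>R (A ^^ k) x) = (\<lambda>k. if k = 0 then x else 0)"
    by (auto simp: fun_eq_iff)
  then show ?thesis
    using sums_single[of 0 "\<lambda>_. x"] by (simp add: op_exp_def sums_iff)
qed

text \<open>Differentiation lowers each exponent by one and kills the constant term, so one summand
  is lost and one factor \<open>A\<close> is handed to \<open>x\<close>: hence \<open>Suc n\<close>
  on one side and \<open>n\<close> on the other.\<close>

lemma exp_sum_has_vector_derivative:
  "((\<lambda>t. exp_sum A (Suc n) t x) has_vector_derivative exp_sum A n t (A x)) (at t within S)"
proof (induction n)
  case 0
  then show ?case by (simp add: exp_sum_def)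
next
  case (Suc n)
  have "((\<lambda>t. t ^ Suc n / fact (Suc n)) has_real_derivative (t ^ n / fact n)) (at t within S)"
    using DERIV_cdivide[OF DERIV_pow[of "Suc n" t S], of "fact (Suc n)"]
    by (simp del: of_nat_Suc)
  from has_vector_derivative_scaleR[OF this has_vector_derivative_const, of "(A ^^ Suc n) x"]
  have "((\<lambda>t. (t ^ Suc n / fact (Suc n)) *\<^sub>R (A ^^ Suc n) x) has_vector_derivative
      (t ^ n / fact n) *\<^sub>R (A ^^ Suc n) x) (at t within S)"
    by simp
  from has_vector_derivative_add[OF Suc this] show ?case
    by (simp add: exp_sum_def funpow_swap1)
qed

text \<open>Uniform convergence of the derivatives is available on bounded intervals only; a
  symmetric interval having \<open>t\<close> in its interior suffices.\<close>

lemma op_exp_has_vector_derivative: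
  "((\<lambda>t. op_exp A t x) has_vector_derivative op_exp A t (A x)) (at t)"
proof -
  let ?S = "{- (\<bar>t\<bar> + 1)..\<bar>t\<bar> + 1}"
  have "((\<lambda>t. op_exp A t x) has_vector_derivative op_exp A t (A x)) (at t within ?S)"
  proof (rule has_vector_derivative_uniform_limit)
    show "uniform_limit ?S (\<lambda>n t. exp_sum A n t (A x)) (\<lambda>t. op_exp A t (A x)) sequentially"
      by (rule exp_sum_uniform_limit)
    show "(\<lambda>n. exp_sum A (Suc n) t x) \<longlonglongrightarrow> op_exp A t x" for t
      using exp_sum_tendsto LIMSEQ_Suc by blast
  qed (auto intro: exp_sum_has_vector_derivative)
  moreover have "t \<in> interior ?S"
    by auto
  ultimately show ?thesis
    by (metis at_within_interior)
qed

end

section \<open>Approximation by bounded skew operators\<close>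

text \<open>Product rule, after which skewness moves the \<open>A\<close> that comes from the second
  factor onto the first. In this form the derivative visibly vanishes for
  \<open>B = A\<close>.\<close>

lemma skew_op_exp_inner_has_derivative:
  fixes A B :: "'a::{real_inner,banach} \<Rightarrow> 'a"
  assumes A: "bounded_linear A" and B: "bounded_linear B"
    and skew: "\<And>x y. inner (A x) y = - inner x (A y)"
  shows "((\<lambda>s. inner (op_exp B s z) (op_exp A (s - t) y)) has_real_derivative
           inner (op_exp B s (B z)) (op_exp A (s - t) y) - inner (A (op_exp B s z)) (op_exp A (s - t) y)) (at s)"
proof -
  have "((\<lambda>s. op_exp A (s - t) y) has_vector_derivative op_exp A (s - t) (A y)) (at s)"
    using vector_diff_chain_at[of "\<lambda>s. s - t" 1 s "\<lambda>t. op_exp A t y", OF _ 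
        op_exp_has_vector_derivative[OF A]]
    by (simp add: o_def has_vector_derivative_diff_const)
  from bounded_bilinear.has_vector_derivative[OF bounded_bilinear_inner
      op_exp_has_vector_derivative[OF B] this]
  show ?thesis
    by (simp add: has_real_derivative_iff_has_vector_derivative skew
        op_exp_commute[OF A A refl] algebra_simps)
qed

text \<open>Skewness makes \<open>A x\<close> orthogonal to \<open>x\<close>, so the squared norm
  along the evolution has derivative zero.\<close>

lemma norm_skew_op_exp:
  fixes A :: "'a::{real_inner,banach} \<Rightarrow> 'a"
  assumes A: "bounded_linear A" and skew: "\<And>x y. inner (A x) y = - inner x (A y)"
  shows "norm (op_exp A t x) = norm x"
proof -
  have zero: "inner x (A x) = 0" for x
    using skew[of x x] by (simp add: inner_commute)
  have "((\<lambda>t. inner (op_exp A t x) (op_exp A t x)) has_real_derivative 0) (at t)" for t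
    using bounded_bilinear.has_vector_derivative[OF bounded_bilinear_inner
        op_exp_has_vector_derivative[OF A, of x t] op_exp_has_vector_derivative[OF A, of x t]]
    by (simp add: has_real_derivative_iff_has_vector_derivative zero inner_commute
        op_exp_commute[OF A A refl, symmetric])
  then have "inner (op_exp A t x) (op_exp A t x) = inner (op_exp A 0 x) (op_exp A 0 x)"
    by (intro DERIV_isconst_all) auto
  then show ?thesis
    by (simp add: A norm_eq_sqrt_inner)
qed

text \<open>The pairing of \<open>op_exp B s z\<close> with \<open>op_exp A (s - t) y\<close> interpolates between the two
  exponentials, and its derivative in \<open>s\<close> only involves \<open>B z - A z\<close>.\<close>

lemma norm_op_exp_diff_le:
  fixes A B :: "'a::{real_inner,banach} \<Rightarrow> 'a"
  assumes A: "bounded_linear A" and B: "bounded_linear B"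
    and skewA: "\<And>x y. inner (A x) y = - inner x (A y)"
    and skewB: "\<And>x y. inner (B x) y = - inner x (B y)"
    and comm: "\<And>x. A (B x) = B (A x)"
  shows "norm (op_exp B t z - op_exp A t z) \<le> \<bar>t\<bar> * norm (B z - A z)"
proof -
  \<comment> \<open>Stated for a general \<open>C\<close> commuting with \<open>A\<close> because it
    is used twice: \<open>C = A\<close> has right-hand side zero and identifies the adjoint of
    \<open>op_exp A t\<close> as \<open>op_exp A (- t)\<close>; \<open>C = B\<close> gives the
    estimate.\<close>
  have bound: "\<bar>inner (op_exp C t z) y - inner z (op_exp A (- t) y)\<bar> \<le> \<bar>t\<bar> * norm (C z - A z) * norm y"
    if C: "bounded_linear C" and skewC: "\<And>x y. inner (C x) y = - inner x (C y)"
      and commC: "\<And>x. A (C x) = C (A x)" for C y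
  proof -
    let ?g = "\<lambda>s. inner (op_exp C s z) (op_exp A (s - t) y)"
    have der: "(?g has_real_derivative inner (op_exp C s (C z - A z)) (op_exp A (s - t) y)) (at s)" for s
      using skew_op_exp_inner_has_derivative[OF A C skewA, of z t y s]
      by (simp add: op_exp_diff[OF C] op_exp_commute[OF C A commC] inner_diff_left)
    have "norm (inner (op_exp C s (C z - A z)) (op_exp A (s - t) y)) \<le> norm (C z - A z) * norm y" for s
      using Cauchy_Schwarz_ineq2[of "op_exp C s (C z - A z)" "op_exp A (s - t) y"]
      by (simp add: norm_skew_op_exp C skewC A skewA)
    then have "norm (?g t - ?g 0) \<le> norm (C z - A z) * norm y * norm (t - 0)"
      by (intro field_differentiable_bound[of UNIV ?g]) (use der in auto)
    then show ?thesis
      by (simp add: A C mult_ac)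
  qed
  have adj: "inner z (op_exp A (- t) y) = inner (op_exp A t z) y" for y
    using bound[OF A skewA refl, of y] by simp
  \<comment> \<open>Pairing with the difference itself turns the bound on inner products into a
    bound on the norm.\<close>
  let ?d = "op_exp B t z - op_exp A t z"
  have "norm ?d * norm ?d = \<bar>inner ?d ?d\<bar>"
    by (simp add: norm_eq_sqrt_inner)
  also have "\<dots> \<le> \<bar>t\<bar> * norm (B z - A z) * norm ?d"
    using bound[OF B skewB comm, of ?d] by (simp add: adj inner_diff_left)
  finally show ?thesis
    by (cases "norm ?d = 0") (auto simp: mult_le_cancel_right)
qed

text \<open>Serves a product rule done by hand in \<open>weak_solution_zero\<close>, where one
  factor has no derivative in norm.\<close>

lemma has_vector_derivative_quotient_tendsto:
  assumes "(f has_vector_derivative f') (at x within S)"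
  shows "((\<lambda>y. (f y - f x) /\<^sub>R (y - x)) \<longlongrightarrow> f') (at x within S)"
proof -
  have "((\<lambda>y. norm ((f y - f x) - (y - x) *\<^sub>R f') / norm (y - x)) \<longlongrightarrow> 0) (at x within S)"
    using assms by (simp add: has_vector_derivative_def has_derivative_iff_norm)
  moreover have "norm ((f y - f x) - (y - x) *\<^sub>R f') / norm (y - x) = norm ((f y - f x) /\<^sub>R (y - x) - f')"
    if "y \<noteq> x" for y
  proof -
    have "(f y - f x) /\<^sub>R (y - x) - f' = ((f y - f x) - (y - x) *\<^sub>R f') /\<^sub>R (y - x)"
      using that by (simp add: scaleR_diff_right)
    then show ?thesis
      by (simp add: divide_inverse_commute)
  qed
  then have "\<forall>\<^sub>F y in at x within S. norm ((f y - f x) - (y - x) *\<^sub>R f') / norm (y - x) =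
      norm ((f y - f x) /\<^sub>R (y - x) - f')"
    by (simp add: eventually_at_filter)
  ultimately have "((\<lambda>y. norm ((f y - f x) /\<^sub>R (y - x) - f')) \<longlongrightarrow> 0) (at x within S)"
    by (rule Lim_transform_eventually)
  then show ?thesis
    using tendsto_norm_zero_iff Lim_null by blast
qed

text \<open>\<open>L\<close> is a total function, but only its values on \<open>D\<close> are
  constrained. Commutativity across different indices is what allows
  \<open>norm_op_exp_diff_le\<close> to compare two approximations.\<close>

locale skew_approximation =
  fixes A :: "nat \<Rightarrow> 'a::{real_inner,banach} \<Rightarrow> 'a" and D :: "'a set" and L :: "'a \<Rightarrow> 'a"
  assumes bounded: "bounded_linear (A n)"
    and skew: "inner (A n x) y = - inner x (A n y)"
    and commute: "A m (A n x) = A n (A m x)"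
    and subspace: "subspace D"
    and dense: "closure D = UNIV"
    and invariant: "z \<in> D \<Longrightarrow> A n z \<in> D"
    and tendsto_L: "z \<in> D \<Longrightarrow> (\<lambda>n. A n z) \<longlonglongrightarrow> L z"
begin

lemma norm_op_exp [simp]: "norm (op_exp (A n) t x) = norm x"
  by (rule norm_skew_op_exp[OF bounded skew])

text \<open>Identities of the \<open>A n\<close> survive the limit on \<open>D\<close>; for the
  concrete operator this replaces integration by parts.\<close>

lemma L_skew:
  assumes "x \<in> D" "y \<in> D"
  shows "inner (L x) y = - inner x (L y)"
proof (rule LIMSEQ_unique)
  show "(\<lambda>n. inner (A n x) y) \<longlonglongrightarrow> inner (L x) y"
    by (intro tendsto_intros tendsto_L assms)
  show "(\<lambda>n. inner (A n x) y) \<longlonglongrightarrow> - inner x (L y)"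
    unfolding skew by (intro tendsto_intros tendsto_L assms)
qed

lemma L_sum:
  assumes "finite I" "\<And>i. i \<in> I \<Longrightarrow> z i \<in> D"
  shows "L (\<Sum>i\<in>I. c i *\<^sub>R z i) = (\<Sum>i\<in>I. c i *\<^sub>R L (z i))"
proof (rule LIMSEQ_unique)
  show "(\<lambda>n. A n (\<Sum>i\<in>I. c i *\<^sub>R z i)) \<longlonglongrightarrow> L (\<Sum>i\<in>I. c i *\<^sub>R z i)"
    using assms by (intro tendsto_L subspace_sum subspace subspace_mul) auto
  have "A n (\<Sum>i\<in>I. c i *\<^sub>R z i) = (\<Sum>i\<in>I. c i *\<^sub>R A n (z i))" for n
    using bounded_linear.linear[OF bounded] by (simp add: linear_sum linear_scale)
  then show "(\<lambda>n. A n (\<Sum>i\<in>I. c i *\<^sub>R z i)) \<longlonglongrightarrow> (\<Sum>i\<in>I. c i *\<^sub>R L (z i))"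
    using assms by (auto intro!: tendsto_intros tendsto_L)
qed

lemma L_commute:
  assumes "z \<in> D"
  shows "L (A n z) = A n (L z)"
proof (rule LIMSEQ_unique)
  show "(\<lambda>m. A m (A n z)) \<longlonglongrightarrow> L (A n z)"
    by (intro tendsto_L invariant assms)
  show "(\<lambda>m. A m (A n z)) \<longlonglongrightarrow> A n (L z)"
    by (subst commute) (intro bounded_linear.tendsto[OF bounded] tendsto_L assms)
qed

text \<open>Replace \<open>x\<close> by a nearby \<open>z\<close> in \<open>D\<close>. The
  exponentials are isometries, so this costs at most \<open>e / 4\<close> for each index and every
  time, while on \<open>z\<close> the two exponentials differ by at most
  \<open>e / 2\<close>.\<close>

lemma op_exp_uniformly_convergent:
  "uniformly_convergent_on {-T..T} (\<lambda>n t. op_exp (A n) t x)"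
proof (rule Cauchy_uniformly_convergent, unfold uniformly_Cauchy_on_def, intro allI impI)
  fix e :: real
  assume "e > 0"
  have "x \<in> closure D"
    by (simp add: dense)
  then obtain z where z: "z \<in> D" "dist z x < e / 4"
    using \<open>e > 0\<close> unfolding closure_approachable by (meson divide_pos_pos zero_less_numeral)
  \<comment> \<open>Chosen so that a time of size at most \<open>T\<close> times \<open>d\<close>
    stays below \<open>e / 2\<close>; adding 1 avoids a zero denominator.\<close>
  define d where "d = e / (2 * (\<bar>T\<bar> + 1))"
  have "d > 0"
    using \<open>e > 0\<close> by (simp add: d_def)
  then obtain M where M: "\<And>m n. m \<ge> M \<Longrightarrow> n \<ge> M \<Longrightarrow> norm (A m z - A n z) < d"
    using LIMSEQ_imp_Cauchy[OF tendsto_L[OF z(1)]] unfolding Cauchy_def dist_norm by meson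
  have "dist (op_exp (A m) t x) (op_exp (A n) t x) < e"
    if t: "t \<in> {-T..T}" and mn: "m \<ge> M" "n \<ge> M" for t m n
  proof -
    have "norm (op_exp (A m) t z - op_exp (A n) t z) \<le> \<bar>t\<bar> * norm (A m z - A n z)"
      by (rule norm_op_exp_diff_le) (auto simp: bounded skew intro: commute)
    also have "\<dots> \<le> (\<bar>T\<bar> + 1) * d"
      using M[OF mn] t by (intro mult_mono) auto
    also have "\<dots> = e / 2"
      by (auto simp: d_def field_simps)
    finally have 1: "norm (op_exp (A m) t z - op_exp (A n) t z) \<le> e / 2" .
    have 2: "norm (op_exp (A k) t x - op_exp (A k) t z) < e / 4" for k
      using z(2) by (simp add: dist_norm norm_minus_commute flip: op_exp_diff[OF bounded])
    let ?a = "op_exp (A m) t x - op_exp (A m) t z" and ?b = "op_exp (A m) t z - op_exp (A n) t z"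
      and ?c = "op_exp (A n) t x - op_exp (A n) t z"
    have "norm (?a + ?b - ?c) < e"
      using norm_triangle_ineq4[of "?a + ?b" ?c] norm_triangle_ineq[of ?a ?b] 1 2[of m] 2[of n]
      by linarith
    then show ?thesis
      by (simp add: dist_norm)
  qed
  then show "\<exists>M. \<forall>x'\<in>{-T..T}. \<forall>m\<ge>M. \<forall>n\<ge>M. dist (op_exp (A m) x' x) (op_exp (A n) x' x) < e"
    by blast
qed

definition flow :: "real \<Rightarrow> 'a \<Rightarrow> 'a" where
  "flow t x = lim (\<lambda>n. op_exp (A n) t x)"

lemma flow_uniform_limit:
  "uniform_limit {-T..T} (\<lambda>n t. op_exp (A n) t x) (\<lambda>t. flow t x) sequentially"
  using op_exp_uniformly_convergent unfolding uniformly_convergent_uniform_limit_iff flow_def .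

lemma op_exp_tendsto_flow: "(\<lambda>n. op_exp (A n) t x) \<longlonglongrightarrow> flow t x"
proof -
  have "t \<in> {- \<bar>t\<bar>..\<bar>t\<bar>}"
    by (auto simp: abs_if)
  then show ?thesis
    by (rule tendsto_uniform_limitI[OF flow_uniform_limit])
qed

lemma norm_flow: "norm (flow t x) = norm x"
  using tendsto_norm[OF op_exp_tendsto_flow[of t x]] by (simp add: LIMSEQ_const_iff)

lemma flow_0: "flow 0 x = x"
  using op_exp_tendsto_flow[of 0 x] by (simp add: bounded LIMSEQ_const_iff)

lemma continuous_flow: "continuous_on UNIV (\<lambda>t. flow t x)"
proof -
  have "isCont (\<lambda>t. flow t x) t" for t
  proof -
    let ?S = "{- (\<bar>t\<bar> + 1)..\<bar>t\<bar> + 1}"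
    have "continuous_on ?S (\<lambda>t. flow t x)"
    proof (rule uniform_limit_theorem[OF _ flow_uniform_limit])
      show "\<forall>\<^sub>F n in sequentially. continuous_on ?S (\<lambda>t. op_exp (A n) t x)"
        by (auto intro!: always_eventually continuous_at_imp_continuous_on
            has_vector_derivative_continuous op_exp_has_vector_derivative[OF bounded])
    qed auto
    moreover have "t \<in> interior ?S"
      by auto
    ultimately show ?thesis
      using continuous_on_interior by blast
  qed
  then show ?thesis
    by (simp add: continuous_at_imp_continuous_on)
qed

text \<open>Skewness puts the operator on \<open>z\<close>, where \<open>A n z\<close> converges.
  Hence \<open>x\<close> may be arbitrary, although the orbit of a general \<open>x\<close> need not
  be differentiable in norm.\<close>

lemma flow_weak_derivative:
  assumes "z \<in> D"
  shows "((\<lambda>t. inner (flow t x) z) has_real_derivative - inner (flow t x) (L z)) (at t)"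
proof -
  let ?S = "{- (\<bar>t\<bar> + 1)..\<bar>t\<bar> + 1}"
  have "((\<lambda>t. inner (flow t x) z) has_vector_derivative - inner (flow t x) (L z)) (at t within ?S)"
  proof (rule has_vector_derivative_uniform_limit)
    show "((\<lambda>t. inner (op_exp (A n) t x) z) has_vector_derivative
        - inner (op_exp (A n) s x) (A n z)) (at s within ?S)" for n s
      using bounded_linear.has_vector_derivative[OF bounded_linear_inner_left
          has_vector_derivative_at_within[OF op_exp_has_vector_derivative[OF bounded]]]
      by (simp add: op_exp_commute[OF bounded bounded refl, symmetric] skew)
    have "uniform_limit ?S (\<lambda>n s. A n z) (\<lambda>s. L z) sequentially"
      using tendsto_L[OF assms] by (simp add: uniform_limit_iff tendsto_iff eventually_mono)
    moreover have "bounded ((\<lambda>s. L z) ` ?S)"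
      by (rule bounded_subset[of "{L z}"]) auto
    moreover have "bounded ((\<lambda>s. flow s x) ` ?S)"
      by (rule boundedI[of _ "norm x"]) (auto simp: norm_flow)
    ultimately have "uniform_limit ?S (\<lambda>n s. inner (op_exp (A n) s x) (A n z))
        (\<lambda>s. inner (flow s x) (L z)) sequentially"
      by (rule bounded_bilinear.bounded_uniform_limit[OF bounded_bilinear_inner flow_uniform_limit])
    then show "uniform_limit ?S (\<lambda>n s. - inner (op_exp (A n) s x) (A n z))
        (\<lambda>s. - inner (flow s x) (L z)) sequentially"
      by (rule uniform_limit_uminus)
    show "(\<lambda>n. inner (op_exp (A n) s x) z) \<longlonglongrightarrow> inner (flow s x) z" for s
      by (intro tendsto_intros op_exp_tendsto_flow)
  qed auto
  moreover have "t \<in> interior ?S"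
    by auto
  ultimately show ?thesis
    by (simp only: at_within_interior has_real_derivative_iff_has_vector_derivative)
qed

section \<open>Uniqueness of weak solutions in the abstract setting\<close>

lemma funpow_L:
  assumes "z \<in> D"
  shows "(A n ^^ k) z \<in> D \<and> L ((A n ^^ k) z) = (A n ^^ k) (L z)"
  by (induction k) (auto simp: assms invariant L_commute)

lemma exp_sum_L:
  assumes "z \<in> D"
  shows "exp_sum (A n) k t z \<in> D" "L (exp_sum (A n) k t z) = exp_sum (A n) k t (L z)"
  using funpow_L[OF assms] unfolding exp_sum_def
  by (auto simp: L_sum intro!: subspace_sum subspace_mul subspace)

text \<open>\<open>op_exp (A n) s z\<close> need not lie in \<open>D\<close>, but it lies in the domain of the closure of \<open>L\<close>,
  since the partial sums of the exponential series lie in \<open>D\<close>.\<close>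

lemma weak_derivative_op_exp:
  assumes v: "continuous_on {0..} v"
    and weak: "\<And>z t. z \<in> D \<Longrightarrow> t \<ge> 0 \<Longrightarrow>
      ((\<lambda>r. inner (v r) z) has_real_derivative - inner (v t) (L z)) (at t within {0..})"
    and z: "z \<in> D" and t: "t \<ge> 0"
  shows "((\<lambda>r. inner (v r) (op_exp (A n) s z)) has_real_derivative
           - inner (v t) (op_exp (A n) s (L z))) (at t within {0..})"
proof -
  let ?S = "{0..t + 1}"
  have cont: "continuous_on ?S v"
    using v by (rule continuous_on_subset) auto
  have "((\<lambda>r. inner (v r) (op_exp (A n) s z)) has_vector_derivative
           - inner (v t) (op_exp (A n) s (L z))) (at t within ?S)"
  proof (rule has_vector_derivative_uniform_limit)
    show "((\<lambda>r. inner (v r) (exp_sum (A n) k s z)) has_vector_derivative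
           - inner (v r) (exp_sum (A n) k s (L z))) (at r within ?S)" if "r \<in> ?S" for k r
      using weak[OF exp_sum_L(1)[OF z], of r n k s] that
      by (auto simp: exp_sum_L(2)[OF z] has_real_derivative_iff_has_vector_derivative
          intro: has_vector_derivative_within_subset)
    have "uniform_limit ?S (\<lambda>k r. exp_sum (A n) k s (L z)) (\<lambda>r. op_exp (A n) s (L z)) sequentially"
      using exp_sum_tendsto[OF bounded] by (simp add: uniform_limit_iff tendsto_iff eventually_mono)
    moreover have "bounded ((\<lambda>r. op_exp (A n) s (L z)) ` ?S)"
      by (rule bounded_subset[of "{op_exp (A n) s (L z)}"]) auto
    moreover have "bounded (v ` ?S)"
      by (intro compact_imp_bounded compact_continuous_image cont) auto
    ultimately have "uniform_limit ?S (\<lambda>k r. inner (v r) (exp_sum (A n) k s (L z)))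
        (\<lambda>r. inner (v r) (op_exp (A n) s (L z))) sequentially"
      by (rule bounded_bilinear.bounded_uniform_limit[OF bounded_bilinear_inner uniform_limit_const])
    then show "uniform_limit ?S (\<lambda>k r. - inner (v r) (exp_sum (A n) k s (L z)))
        (\<lambda>r. - inner (v r) (op_exp (A n) s (L z))) sequentially"
      by (rule uniform_limit_uminus)
    show "(\<lambda>k. inner (v r) (exp_sum (A n) k s z)) \<longlonglongrightarrow> inner (v r) (op_exp (A n) s z)" for r
      by (rule tendsto_inner[OF tendsto_const exp_sum_tendsto[OF bounded]])
  qed (use t in auto)
  moreover have "at t within ?S = at t within {0..}"
    by (rule at_within_nhd[of _ "{..<t + 1}"]) auto
  ultimately show ?thesis
    by (simp only: has_real_derivative_iff_has_vector_derivative)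
qed

text \<open>The pairing of \<open>v s\<close> with \<open>op_exp (A n) (s - t) z\<close> is zero at
  \<open>s = 0\<close> and equals \<open>inner (v t) z\<close> at \<open>s = t\<close>. Its
  derivative is the pairing of \<open>v s\<close> with the evolved defect
  \<open>A n z - L z\<close>, so the mean value bound tends to zero as \<open>n\<close>
  grows.\<close>

lemma weak_solution_zero:
  assumes v: "continuous_on {0..} v"
    and weak: "\<And>z t. z \<in> D \<Longrightarrow> t \<ge> 0 \<Longrightarrow>
      ((\<lambda>r. inner (v r) z) has_real_derivative - inner (v t) (L z)) (at t within {0..})"
    and v0: "v 0 = 0" and t: "t \<ge> 0"
  shows "v t = 0"
proof -
  have "inner (v t) z = 0" if z: "z \<in> D" for z
  proof -
    have "bounded (v ` {0..t})"
      by (intro compact_imp_bounded compact_continuous_image continuous_on_subset[OF v]) auto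
    then obtain M where M: "\<And>s. s \<in> {0..t} \<Longrightarrow> norm (v s) \<le> M"
      unfolding bounded_iff by blast
    have "M \<ge> 0"
      using M[of t] t norm_ge_zero order_trans by (metis atLeastAtMost_iff order_refl)
    have bound: "\<bar>inner (v t) z\<bar> \<le> M * norm (A n z - L z) * t" for n
    proof -
      let ?y = "\<lambda>s. op_exp (A n) (s - t) z"
      let ?g' = "\<lambda>s. inner (v s) (op_exp (A n) (s - t) (A n z - L z))"
      have "((\<lambda>s. inner (v s) (?y s)) has_real_derivative ?g' s) (at s within {0..t})"
        if s: "s \<in> {0..t}" for s
      proof -
        have "(?y has_vector_derivative op_exp (A n) (s - t) (A n z)) (at s within {0..})"
          using vector_diff_chain_at[of "\<lambda>s. s - t" 1 s "\<lambda>t. op_exp (A n) t z", OF _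
              op_exp_has_vector_derivative[OF bounded]]
          by (simp add: o_def has_vector_derivative_diff_const has_vector_derivative_at_within)
        then have y': "((\<lambda>r. (?y r - ?y s) /\<^sub>R (r - s)) \<longlongrightarrow> op_exp (A n) (s - t) (A n z)) (at s within {0..})"
          by (rule has_vector_derivative_quotient_tendsto)
        \<comment> \<open>Product rule by hand: \<open>v\<close> is continuous in norm but only
          weakly differentiable. The quotient with the increment of \<open>?y\<close> therefore
          needs just continuity of \<open>v\<close>, and the quotient with the increment of
          \<open>v\<close> is tested against the fixed vector \<open>?y s\<close>.\<close>
        have "(v \<longlongrightarrow> v s) (at s within {0..})"
          using v s by (auto simp: continuous_on_def)
        from tendsto_inner[OF this y']
        have 1: "((\<lambda>r. inner (v r) (?y r - ?y s) / (r - s)) \<longlongrightarrow>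
            inner (v s) (op_exp (A n) (s - t) (A n z))) (at s within {0..})"
          by (simp add: divide_inverse_commute)
        have 2: "((\<lambda>r. (inner (v r) (?y s) - inner (v s) (?y s)) / (r - s)) \<longlongrightarrow>
            - inner (v s) (op_exp (A n) (s - t) (L z))) (at s within {0..})"
          using weak_derivative_op_exp[OF v weak z, of s n "s - t"] s
          by (simp add: has_field_derivative_iff)
        have "((\<lambda>r. (inner (v r) (?y r) - inner (v s) (?y s)) / (r - s)) \<longlongrightarrow> ?g' s) (at s within {0..})"
          using tendsto_add[OF 1 2]
          by (simp add: inner_diff_right op_exp_diff[OF bounded] diff_divide_distrib)
        then show ?thesis
          using DERIV_subset[of _ _ s "{0..}" "{0..t}"] by (auto simp: has_field_derivative_iff)
      qed
      moreover have "norm (?g' s) \<le> M * norm (A n z - L z)" if s: "s \<in> {0..t}" for s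
      proof -
        have "norm (?g' s) \<le> norm (v s) * norm (A n z - L z)"
          using Cauchy_Schwarz_ineq2[of "v s" "op_exp (A n) (s - t) (A n z - L z)"] by simp
        also have "\<dots> \<le> M * norm (A n z - L z)"
          using M[OF s] by (intro mult_right_mono) auto
        finally show ?thesis .
      qed
      ultimately have "norm (inner (v t) (?y t) - inner (v 0) (?y 0)) \<le> M * norm (A n z - L z) * norm (t - 0)"
        using t by (intro field_differentiable_bound[of "{0..t}"]) auto
      then show ?thesis
        using t by (simp add: v0 bounded)
    qed
    have "(\<lambda>n. M * norm (A n z - L z) * t) \<longlonglongrightarrow> M * norm (L z - L z) * t"
      by (intro tendsto_intros tendsto_L z)
    then have "\<bar>inner (v t) z\<bar> \<le> M * norm (L z - L z) * t"
      by (rule LIMSEQ_le_const) (use bound in blast)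
    then show ?thesis
      by simp
  qed
  \<comment> \<open>Approximating \<open>v t\<close> itself from \<open>D\<close> makes
    \<open>inner (v t) (v t)\<close> a limit of zeros.\<close>
  moreover have "v t \<in> closure D"
    by (simp add: dense)
  then obtain z where "\<And>n. z n \<in> D" "z \<longlonglongrightarrow> v t"
    unfolding closure_sequential by blast
  ultimately have "(\<lambda>n. 0) \<longlonglongrightarrow> inner (v t) (v t)"
    using tendsto_inner[OF tendsto_const, of z "v t" sequentially "v t"] by simp
  then show ?thesis
    by (simp add: LIMSEQ_const_iff)
qed

end

section \<open>The Hilbert space of square-integrable functions\<close>

lemma in_L2_measurable: "in_L2 f \<Longrightarrow> f \<in> borel_measurable lborel"
  and in_L2_integrable: "in_L2 f \<Longrightarrow> integrable lborel (\<lambda>s. (f s)\<^sup>2)"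
  by (simp_all add: in_L2_def)

lemma in_L2_zero: "in_L2 (\<lambda>s. 0)"
  by (simp add: in_L2_def)

lemma in_L2_scale:
  assumes "in_L2 f"
  shows "in_L2 (\<lambda>s. c * f s)"
  using assms by (auto simp: in_L2_def power_mult_distrib)

lemma in_L2_add:
  assumes f: "in_L2 f" and g: "in_L2 g"
  shows "in_L2 (\<lambda>s. f s + g s)"
  unfolding in_L2_def
proof
  have [measurable]: "f \<in> borel_measurable lborel" "g \<in> borel_measurable lborel"
    using f g by (simp_all add: in_L2_def)
  show "(\<lambda>s. f s + g s) \<in> borel_measurable lborel"
    by measurable
  show "integrable lborel (\<lambda>s. (f s + g s)\<^sup>2)"
  proof (rule Bochner_Integration.integrable_bound)
    show "integrable lborel (\<lambda>s. 2 * (f s)\<^sup>2 + 2 * (g s)\<^sup>2)"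
      using f g by (simp add: in_L2_def)
    have "(f s + g s)\<^sup>2 \<le> 2 * (f s)\<^sup>2 + 2 * (g s)\<^sup>2" for s
      using sum_squares_ge_zero[of "f s - g s" 0] by (simp add: power2_eq_square algebra_simps)
    then show "AE s in lborel. norm ((f s + g s)\<^sup>2) \<le> norm (2 * (f s)\<^sup>2 + 2 * (g s)\<^sup>2)"
      by simp
  qed measurable
qed

lemma in_L2_uminus: "in_L2 f \<Longrightarrow> in_L2 (\<lambda>s. - f s)"
  using in_L2_scale[of f "-1"] by simp

lemma in_L2_diff: "in_L2 f \<Longrightarrow> in_L2 g \<Longrightarrow> in_L2 (\<lambda>s. f s - g s)"
  using in_L2_add[OF _ in_L2_uminus, of f g] by simp

lemma in_L2_integrable_mult:
  assumes f: "in_L2 f" and g: "in_L2 g"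
  shows "integrable lborel (\<lambda>s. f s * g s)"
proof (rule Bochner_Integration.integrable_bound)
  have [measurable]: "f \<in> borel_measurable lborel" "g \<in> borel_measurable lborel"
    using f g by (simp_all add: in_L2_def)
  show "(\<lambda>s. f s * g s) \<in> borel_measurable lborel"
    by measurable
  show "integrable lborel (\<lambda>s. (f s)\<^sup>2 + (g s)\<^sup>2)"
    using f g by (simp add: in_L2_def)
  have "\<bar>f s * g s\<bar> \<le> (f s)\<^sup>2 + (g s)\<^sup>2" for s
  proof -
    have "2 * (\<bar>f s\<bar> * \<bar>g s\<bar>) \<le> (f s)\<^sup>2 + (g s)\<^sup>2"
      using zero_le_power2[of "\<bar>f s\<bar> - \<bar>g s\<bar>"] by (simp add: power2_diff)
    then show ?thesis
      by (simp add: abs_mult) (use mult_nonneg_nonneg[of "\<bar>f s\<bar>" "\<bar>g s\<bar>"] in linarith)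
  qed
  then show "AE s in lborel. norm (f s * g s) \<le> norm ((f s)\<^sup>2 + (g s)\<^sup>2)"
    by simp
qed

definition l2_rel :: "(real \<Rightarrow> real) \<Rightarrow> (real \<Rightarrow> real) \<Rightarrow> bool" where
  "l2_rel f g \<longleftrightarrow> in_L2 f \<and> in_L2 g \<and> (AE s in lborel. f s = g s)"

\<comment> \<open>A quotient is needed because \<open>real_inner\<close> demands that only zero has
  norm zero, and the abstract evolution lemmas live in the classes \<open>real_inner\<close> and
  \<open>banach\<close>. The relation is partial, so every class consists of square-integrable
  functions.\<close>
quotient_type l2 = "real \<Rightarrow> real" / partial: l2_rel
proof (rule part_equivpI)
  show "\<exists>f. l2_rel f f"
    using in_L2_zero by (auto simp: l2_rel_def)
  show "symp l2_rel"
    by (auto simp: symp_def l2_rel_def elim: eventually_mono)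
  show "transp l2_rel"
    by (auto simp: transp_def l2_rel_def elim: eventually_elim2)
qed

lemma in_L2_rep: "in_L2 (rep_l2 x)"
  using Quotient3_rep_reflp[OF Quotient3_l2, of x] by (simp add: l2_rel_def)

lemma abs_rep_l2: "abs_l2 (rep_l2 x) = x"
  by (rule Quotient3_abs_rep[OF Quotient3_l2])

lemma abs_l2_eq_iff:
  assumes "in_L2 f" "in_L2 g"
  shows "abs_l2 f = abs_l2 g \<longleftrightarrow> (AE s in lborel. f s = g s)"
  using Quotient3_rel[OF Quotient3_l2, of f g] assms by (simp add: l2_rel_def)

lemma rep_abs_l2:
  assumes "in_L2 f"
  shows "AE s in lborel. rep_l2 (abs_l2 f) s = f s"
  using abs_l2_eq_iff[OF in_L2_rep assms, of "abs_l2 f"] by (simp add: abs_rep_l2)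

instantiation l2 :: real_inner
begin

lift_definition zero_l2 :: l2 is "\<lambda>s. 0"
  by (simp add: l2_rel_def in_L2_zero)

lift_definition plus_l2 :: "l2 \<Rightarrow> l2 \<Rightarrow> l2" is "\<lambda>f g s. f s + g s"
  by (auto simp: l2_rel_def intro: in_L2_add elim: eventually_elim2)

lift_definition uminus_l2 :: "l2 \<Rightarrow> l2" is "\<lambda>f s. - f s"
  by (auto simp: l2_rel_def intro: in_L2_uminus elim: eventually_mono)

lift_definition minus_l2 :: "l2 \<Rightarrow> l2 \<Rightarrow> l2" is "\<lambda>f g s. f s - g s"
  by (auto simp: l2_rel_def intro: in_L2_diff elim: eventually_elim2)

lift_definition scaleR_l2 :: "real \<Rightarrow> l2 \<Rightarrow> l2" is "\<lambda>c f s. c * f s"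
  by (auto simp: l2_rel_def intro: in_L2_scale elim: eventually_mono)

lift_definition inner_l2 :: "l2 \<Rightarrow> l2 \<Rightarrow> real" is "\<lambda>f g. LINT s|lborel. f s * g s"
proof (rule integral_cong_AE)
  fix f f' g g'
  assume "l2_rel f f'" "l2_rel g g'"
  then show "AE s in lborel. f s * g s = f' s * g' s" 
    by (auto simp: l2_rel_def elim: eventually_elim2)
qed (auto simp: l2_rel_def in_L2_def intro!: borel_measurable_times)

definition "norm (x :: l2) = sqrt (inner x x)"
definition "dist (x :: l2) y = norm (x - y)"
definition "sgn (x :: l2) = inverse (norm x) *\<^sub>R x"
definition "(uniformity :: (l2 \<times> l2) filter) = (INF e\<in>{0<..}. principal {(x, y). dist x y < e})"
definition "open (U :: l2 set) \<longleftrightarrow> (\<forall>x\<in>U. \<forall>\<^sub>F (x', y) in uniformity. x' = x \<longrightarrow> y \<in> U)"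

instance
proof
  fix x y z :: l2 and a b :: real
  show "x + y + z = x + (y + z)" "x + y = y + x" "0 + x = x" "- x + x = 0" "x - y = x + - y"
    "a *\<^sub>R (x + y) = a *\<^sub>R x + a *\<^sub>R y" "(a + b) *\<^sub>R x = a *\<^sub>R x + b *\<^sub>R x"
    "a *\<^sub>R b *\<^sub>R x = (a * b) *\<^sub>R x" "1 *\<^sub>R x = x"
    by (transfer; auto simp: l2_rel_def algebra_simps intro: in_L2_add in_L2_diff in_L2_scale in_L2_zero)+
  show "inner x y = inner y x"
    by transfer (simp add: mult.commute)
  show "inner (x + y) z = inner x z + inner y z"
    by transfer (simp add: l2_rel_def distrib_right in_L2_integrable_mult)
  show "inner (a *\<^sub>R x) y = a * inner x y"
    by transfer (simp add: mult.assoc)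
  show "0 \<le> inner x x"
    by transfer simp
  show "inner x x = 0 \<longleftrightarrow> x = 0"
  proof transfer
    fix f
    assume "l2_rel f f"
    then have f: "in_L2 f"
      by (simp add: l2_rel_def)
    then have "(LINT s|lborel. f s * f s) = 0 \<longleftrightarrow> (AE s in lborel. f s * f s = 0)"
      by (intro integral_nonneg_eq_0_iff_AE in_L2_integrable_mult) auto
    then show "(LINT s|lborel. f s * f s) = 0 \<longleftrightarrow> l2_rel f (\<lambda>s. 0)"
      using f in_L2_zero by (simp add: l2_rel_def)
  qed
qed (simp_all add: norm_l2_def dist_l2_def sgn_l2_def uniformity_l2_def open_l2_def)

end

lemma abs_l2_add: "in_L2 f \<Longrightarrow> in_L2 g \<Longrightarrow> abs_l2 f + abs_l2 g = abs_l2 (\<lambda>s. f s + g s)"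
  by (simp add: plus_l2.abs_eq l2_rel_def)

lemma abs_l2_diff: "in_L2 f \<Longrightarrow> in_L2 g \<Longrightarrow> abs_l2 f - abs_l2 g = abs_l2 (\<lambda>s. f s - g s)"
  by (simp add: minus_l2.abs_eq l2_rel_def)

lemma abs_l2_scale: "in_L2 f \<Longrightarrow> c *\<^sub>R abs_l2 f = abs_l2 (\<lambda>s. c * f s)"
  by (simp add: scaleR_l2.abs_eq l2_rel_def)

lemma inner_abs_l2: "in_L2 f \<Longrightarrow> in_L2 g \<Longrightarrow> inner (abs_l2 f) (abs_l2 g) = (LINT s|lborel. f s * g s)"
  by (simp add: inner_l2.abs_eq l2_rel_def)

lemma norm_abs_l2: "in_L2 f \<Longrightarrow> norm (abs_l2 f) = L2_norm f"
  by (simp add: norm_l2_def inner_abs_l2 L2_norm_def power2_eq_square)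

lemma norm_abs_l2_diff:
  "in_L2 f \<Longrightarrow> in_L2 g \<Longrightarrow> norm (abs_l2 f - abs_l2 g) = L2_norm (\<lambda>s. f s - g s)"
  by (simp add: abs_l2_diff norm_abs_l2 in_L2_diff)

lemma L2_norm_rep: "L2_norm (rep_l2 x) = norm x"
  using norm_abs_l2[OF in_L2_rep, of x] by (simp add: abs_rep_l2)

text \<open>Riesz--Fischer: along a subsequence with \<open>norm (X (r (k + 1)) - X (r k)) < 1 / 2 ^ k\<close> the
  series of the weighted squares \<open>2 ^ k * (f (k + 1) - f k)\<^sup>2\<close> is integrable, hence finite almost
  everywhere, which forces pointwise convergence; Fatou's lemma does the rest.\<close>

instance l2 :: complete_space
proof
  fix X :: "nat \<Rightarrow> l2"
  assume "Cauchy X"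
  then have "\<exists>N. \<forall>m\<ge>N. \<forall>n\<ge>N. norm (X m - X n) < (1 / 2) ^ k" for k
    unfolding Cauchy_def dist_norm by (meson half_gt_zero_iff zero_less_one zero_less_power)
  then obtain N where N: "\<And>k m n. m \<ge> N k \<Longrightarrow> n \<ge> N k \<Longrightarrow> norm (X m - X n) < (1 / 2) ^ k"
    by metis
  \<comment> \<open>Summing the thresholds makes \<open>r k\<close> exceed \<open>N j\<close> for
    all \<open>j\<close> up to \<open>k\<close>, without assuming that \<open>N\<close> is
    monotone.\<close>
  define r where "r k = (\<Sum>j\<le>k. N j)" for k
  have r: "N j \<le> r k" if "j \<le> k" for j k
    unfolding r_def using that by (intro member_le_sum) auto
  define f where "f k = rep_l2 (X (r k))" for k
  have f: "in_L2 (f k)" for k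
    by (simp add: f_def in_L2_rep)
  note [measurable] = in_L2_measurable[OF f]
  have diff: "integrable lborel (\<lambda>s. (f m s - rep_l2 (X n) s)\<^sup>2)"
    "(LINT s|lborel. (f m s - rep_l2 (X n) s)\<^sup>2) = (norm (X (r m) - X n))\<^sup>2" for m n
  proof -
    show "integrable lborel (\<lambda>s. (f m s - rep_l2 (X n) s)\<^sup>2)"
      by (intro in_L2_integrable in_L2_diff f in_L2_rep)
    have "norm (X (r m) - X n) = L2_norm (\<lambda>s. f m s - rep_l2 (X n) s)"
      using norm_abs_l2_diff[OF f in_L2_rep, of m "X n"] by (simp add: f_def abs_rep_l2)
    then show "(LINT s|lborel. (f m s - rep_l2 (X n) s)\<^sup>2) = (norm (X (r m) - X n))\<^sup>2"
      by (simp add: L2_norm_def)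
  qed
  \<comment> \<open>The weight \<open>2 ^ k\<close> against squared norms of size
    \<open>1 / 4 ^ k\<close> leaves a summable \<open>1 / 2 ^ k\<close>; a finite sum
    \<open>C\<close> then forces increments of at most \<open>sqrt C * sqrt (1 / 2) ^ k\<close>,
    again summable.\<close>
  let ?h = "\<lambda>k s. 2 ^ k * (f (Suc k) s - f k s)\<^sup>2"
  have "(\<integral>\<^sup>+s. (\<Sum>k. ennreal (?h k s)) \<partial>lborel) = (\<Sum>k. \<integral>\<^sup>+s. ennreal (?h k s) \<partial>lborel)"
    by (rule nn_integral_suminf) measurable
  also have "\<dots> \<le> (\<Sum>k. ennreal ((1 / 2) ^ k))"
  proof (intro suminf_le summableI)
    fix k
    have "(norm (X (r (Suc k)) - X (r k)))\<^sup>2 \<le> ((1 / 2) ^ k)\<^sup>2"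
      using N[of k "r (Suc k)" "r k"] by (intro power_mono) (auto simp: r less_imp_le)
    then have "2 ^ k * (norm (X (r (Suc k)) - X (r k)))\<^sup>2 \<le> 2 ^ k * ((1 / 2) ^ k)\<^sup>2"
      by simp
    also have "\<dots> = (1 / 2) ^ k"
      by (simp add: power2_eq_square power_one_over)
    finally have "(LINT s|lborel. ?h k s) \<le> (1 / 2) ^ k"
      using diff[of "Suc k" "r k"] by (simp add: f_def)
    moreover have "(\<integral>\<^sup>+s. ennreal (?h k s) \<partial>lborel) = ennreal (LINT s|lborel. ?h k s)"
      using diff(1)[of "Suc k" "r k"] by (intro nn_integral_eq_integral) (auto simp: f_def)
    ultimately show "(\<integral>\<^sup>+s. ennreal (?h k s) \<partial>lborel) \<le> ennreal ((1 / 2) ^ k)"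
      by (simp add: ennreal_leI)
  qed
  also have "\<dots> = ennreal (\<Sum>k. (1 / 2) ^ k)"
    by (intro suminf_ennreal2) auto
  finally have "(\<integral>\<^sup>+s. (\<Sum>k. ennreal (?h k s)) \<partial>lborel) \<noteq> \<infinity>"
    by (auto simp: top_unique)
  then have AE_finite: "AE s in lborel. (\<Sum>k. ennreal (?h k s)) \<noteq> \<infinity>"
    by (intro nn_integral_PInf_AE) measurable
  have finite_ennreal: "\<exists>C\<ge>0. c = ennreal C" if "c \<noteq> \<infinity>" for c
    using that by (cases c) auto
  from AE_finite have conv: "AE s in lborel. convergent (\<lambda>k. f k s)"
  proof eventually_elim
    case (elim s)
    then obtain C where C: "(\<Sum>k. ennreal (?h k s)) = ennreal C" "C \<ge> 0"
      using finite_ennreal by blast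
    have "\<bar>f (Suc k) s - f k s\<bar> \<le> sqrt C * sqrt (1 / 2) ^ k" for k
    proof -
      have "ennreal (?h k s) \<le> ennreal C"
        unfolding C(1)[symmetric] using sum_le_suminf[OF summableI, of "{k}"] by auto
      then have "?h k s \<le> C"
        using C(2) by (simp add: ennreal_le_iff)
      then have "(f (Suc k) s - f k s)\<^sup>2 \<le> C * (1 / 2) ^ k"
        by (simp add: field_simps)
      then have "sqrt ((f (Suc k) s - f k s)\<^sup>2) \<le> sqrt (C * (1 / 2) ^ k)"
        by (rule real_sqrt_le_mono)
      then show ?thesis
        by (simp only: real_sqrt_abs real_sqrt_mult real_sqrt_power[of "1 / 2"])
    qed
    then have "norm (f (Suc k) s - f k s) \<le> sqrt C * sqrt (1 / 2) ^ k" for k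
      by simp
    moreover have "summable (\<lambda>k. sqrt C * sqrt (1 / 2) ^ k)"
      by (intro summable_mult summable_geometric) (simp add: real_sqrt_divide)
    ultimately have "summable (\<lambda>k. f (Suc k) s - f k s)"
      using summable_comparison_test'[of "\<lambda>k. sqrt C * sqrt (1 / 2) ^ k" 0 "\<lambda>k. f (Suc k) s - f k s"]
      by simp
    then have "convergent (\<lambda>n. f n s - f 0 s)"
      unfolding summable_iff_convergent sum_lessThan_telescope[of "\<lambda>k. f k s"] .
    then have "convergent (\<lambda>n. (f n s - f 0 s) + f 0 s)"
      by (intro convergent_add convergent_const)
    then show ?case
      by simp
  qed
  \<comment> \<open>Where the sequence diverges, \<open>lim\<close> has an unspecified value; this
    happens only on a null set, and \<open>F\<close> is still measurable.\<close>
  define F where "F s = lim (\<lambda>k. f k s)" for s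
  have [measurable]: "F \<in> borel_measurable lborel"
    unfolding F_def by measurable
  have F: "AE s in lborel. (\<lambda>k. f k s) \<longlonglongrightarrow> F s"
    using conv by eventually_elim (simp add: F_def convergent_LIMSEQ_iff)
  \<comment> \<open>Fatou is applied in the subsequence index \<open>m\<close> with \<open>n\<close>
    fixed, so the bound concerns the full sequence \<open>X\<close> and no separate passage from the
    subsequence is required.\<close>
  have tail: "integrable lborel (\<lambda>s. (F s - rep_l2 (X n) s)\<^sup>2) \<and>
      (LINT s|lborel. (F s - rep_l2 (X n) s)\<^sup>2) \<le> ((1 / 2) ^ j)\<^sup>2" if n: "n \<ge> N j" for n j
  proof -
    note [measurable] = in_L2_measurable[OF in_L2_rep]
    have "(\<integral>\<^sup>+s. ennreal ((F s - rep_l2 (X n) s)\<^sup>2) \<partial>lborel) =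
        (\<integral>\<^sup>+s. liminf (\<lambda>m. ennreal ((f m s - rep_l2 (X n) s)\<^sup>2)) \<partial>lborel)"
    proof (rule nn_integral_cong_AE, use F in eventually_elim)
      case (elim s)
      have "(\<lambda>m. ennreal ((f m s - rep_l2 (X n) s)\<^sup>2)) \<longlonglongrightarrow> ennreal ((F s - rep_l2 (X n) s)\<^sup>2)"
        by (intro tendsto_intros elim)
      then show ?case
        by (rule lim_imp_Liminf[OF sequentially_bot, symmetric])
    qed
    also have "\<dots> \<le> liminf (\<lambda>m. \<integral>\<^sup>+s. ennreal ((f m s - rep_l2 (X n) s)\<^sup>2) \<partial>lborel)"
      by (rule nn_integral_liminf) measurable
    also have "\<dots> \<le> ennreal (((1 / 2) ^ j)\<^sup>2)"
    proof (rule Liminf_le)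
      show "\<forall>\<^sub>F m in sequentially. (\<integral>\<^sup>+s. ennreal ((f m s - rep_l2 (X n) s)\<^sup>2) \<partial>lborel) \<le> ennreal (((1 / 2) ^ j)\<^sup>2)"
        using eventually_ge_at_top[of j]
      proof eventually_elim
        case (elim m)
        have "(norm (X (r m) - X n))\<^sup>2 \<le> ((1 / 2) ^ j)\<^sup>2"
          using N[of j "r m" n] elim n by (intro power_mono) (auto simp: r less_imp_le)
        then show ?case
          using diff[of m n] by (subst nn_integral_eq_integral) (auto intro: ennreal_leI)
      qed
    qed simp
    finally have *: "(\<integral>\<^sup>+s. ennreal ((F s - rep_l2 (X n) s)\<^sup>2) \<partial>lborel) \<le> ennreal (((1 / 2) ^ j)\<^sup>2)" .
    then have "integrable lborel (\<lambda>s. (F s - rep_l2 (X n) s)\<^sup>2)"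
      by (intro integrableI_nonneg) (auto intro: order_le_less_trans)
    with * show ?thesis
      by (simp add: nn_integral_eq_integral ennreal_le_iff)
  qed
  have "in_L2 (\<lambda>s. (F s - rep_l2 (X (N 0)) s) + rep_l2 (X (N 0)) s)"
    using tail[of 0 "N 0"] in_L2_measurable[OF in_L2_rep, of "X (N 0)"]
    by (intro in_L2_add in_L2_rep) (auto simp: in_L2_def)
  then have F2: "in_L2 F"
    by simp
  have "X \<longlonglongrightarrow> abs_l2 F"
  proof (rule LIMSEQ_I)
    fix e :: real
    assume "e > 0"
    then obtain j where j: "(1 / 2) ^ j < e"
      using real_arch_pow_inv[of e "1 / 2"] by auto
    have "norm (X n - abs_l2 F) < e" if "n \<ge> N j" for n
    proof -
      have "norm (X n - abs_l2 F) = L2_norm (\<lambda>s. F s - rep_l2 (X n) s)"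
        using norm_abs_l2_diff[OF F2 in_L2_rep, of "X n"] by (simp add: abs_rep_l2 norm_minus_commute)
      also have "\<dots> \<le> (1 / 2) ^ j"
        unfolding L2_norm_def using tail[OF that] by (intro real_le_lsqrt) auto
      finally show ?thesis
        using j by simp
    qed
    then show "\<exists>no. \<forall>n\<ge>no. norm (X n - abs_l2 F) < e"
      by blast
  qed
  then show "convergent X"
    by (rule convergentI)
qed

instance l2 :: banach ..

section \<open>Smooth functions and test functions\<close>

text \<open>A set closed under taking derivatives contains all iterated derivatives of its members.
  Smoothness proofs thereby reduce to exhibiting such a set, with no formula for the derivative of
  order \<open>n\<close>.\<close>

lemma smooth_fun_coinduct:
  assumes "f \<in> S" and step: "\<And>g. g \<in> S \<Longrightarrow> \<exists>g'\<in>S. \<forall>x. (g has_real_derivative g' x) (at x)"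
  shows "smooth_fun f"
proof -
  have deriv_S: "deriv g \<in> S" if g: "g \<in> S" for g
  proof -
    obtain g' where g': "g' \<in> S" "\<And>x. (g has_real_derivative g' x) (at x)"
      using step[OF g] by blast
    have "deriv g = g'"
      using g'(2) by (intro ext DERIV_imp_deriv)
    then show ?thesis
      using g'(1) by simp
  qed
  have "(deriv ^^ n) f \<in> S" for n
    by (induction n) (auto simp: \<open>f \<in> S\<close> deriv_S)
  then show ?thesis
    using step unfolding smooth_fun_def real_differentiable_def by blast
qed

lemma smooth_fun_DERIV: "smooth_fun f \<Longrightarrow> ((deriv ^^ n) f has_real_derivative (deriv ^^ Suc n) f x) (at x)"
  by (simp add: smooth_fun_def DERIV_deriv_iff_real_differentiable)

lemma smooth_fun_DERIV_0: "smooth_fun f \<Longrightarrow> (f has_real_derivative deriv f x) (at x)"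
  using smooth_fun_DERIV[of f 0] by simp

lemma smooth_fun_deriv: "smooth_fun f \<Longrightarrow> smooth_fun (deriv f)"
  unfolding smooth_fun_def by (metis comp_apply funpow_Suc_right)

lemma smooth_fun_continuous_on: "smooth_fun f \<Longrightarrow> continuous_on S f"
  using smooth_fun_DERIV_0 DERIV_isCont continuous_at_imp_continuous_on by metis

lemma smooth_fun_measurable: "smooth_fun f \<Longrightarrow> f \<in> borel_measurable borel"
  by (intro borel_measurable_continuous_onI smooth_fun_continuous_on)

lemma smooth_fun_const: "smooth_fun (\<lambda>x. c)"
  by (rule smooth_fun_coinduct[of _ "range (\<lambda>c x. c)"])
    (auto intro!: exI[of _ 0] derivative_eq_intros)

lemma smooth_fun_add:
  assumes "smooth_fun f" "smooth_fun g"
  shows "smooth_fun (\<lambda>x. f x + g x)"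
proof (rule smooth_fun_coinduct)
  let ?S = "{\<lambda>x. f x + g x | f g. smooth_fun f \<and> smooth_fun g}"
  show "(\<lambda>x. f x + g x) \<in> ?S"
    using assms by blast
  fix h
  assume "h \<in> ?S"
  then obtain f g where h: "h = (\<lambda>x. f x + g x)" "smooth_fun f" "smooth_fun g"
    by blast
  then have "(\<lambda>x. deriv f x + deriv g x) \<in> ?S"
    using smooth_fun_deriv by blast
  then show "\<exists>h'\<in>?S. \<forall>x. (h has_real_derivative h' x) (at x)"
    using h by (auto intro!: bexI[of _ "\<lambda>x. deriv f x + deriv g x"] DERIV_add smooth_fun_DERIV_0)
qed

lemma smooth_fun_affine:
  assumes "smooth_fun f"
  shows "smooth_fun (\<lambda>x. c * f (k * x + d))"
proof (rule smooth_fun_coinduct)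
  let ?S = "{\<lambda>x. c * f (k * x + d) | c f. smooth_fun f}"
  show "(\<lambda>x. c * f (k * x + d)) \<in> ?S"
    using assms by blast
  fix h
  assume "h \<in> ?S"
  then obtain c f where h: "h = (\<lambda>x. c * f (k * x + d))" "smooth_fun f"
    by blast
  then have "(\<lambda>x. (c * k) * deriv f (k * x + d)) \<in> ?S"
    using smooth_fun_deriv by blast
  moreover have "(h has_real_derivative (c * k) * deriv f (k * x + d)) (at x)" for x
    unfolding h(1)
    by (auto intro!: derivative_eq_intros DERIV_chain2[OF smooth_fun_DERIV_0[OF h(2)]])
  ultimately show "\<exists>h'\<in>?S. \<forall>x. (h has_real_derivative h' x) (at x)"
    by (intro bexI[where x = "\<lambda>x. (c * k) * deriv f (k * x + d)"]) auto
qed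

lemma smooth_fun_scale: "smooth_fun f \<Longrightarrow> smooth_fun (\<lambda>x. c * f x)"
  using smooth_fun_affine[of f c 1 0] by simp

lemma smooth_fun_shift: "smooth_fun f \<Longrightarrow> smooth_fun (\<lambda>x. f (x + h))"
  using smooth_fun_affine[of f 1 1 h] by simp

text \<open>The derivative of a product is a sum of two products; closing the products under sums
  gives a set fit for \<open>smooth_fun_coinduct\<close> and avoids the Leibniz formula.\<close>

inductive_set smooth_products :: "(real \<Rightarrow> real) set" where
  mult: "smooth_fun f \<Longrightarrow> smooth_fun g \<Longrightarrow> (\<lambda>x. f x * g x) \<in> smooth_products"
| add: "f \<in> smooth_products \<Longrightarrow> g \<in> smooth_products \<Longrightarrow> (\<lambda>x. f x + g x) \<in> smooth_products"

lemma smooth_fun_mult: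
  assumes "smooth_fun f" "smooth_fun g"
  shows "smooth_fun (\<lambda>x. f x * g x)"
proof (rule smooth_fun_coinduct)
  show "(\<lambda>x. f x * g x) \<in> smooth_products"
    using assms by (rule smooth_products.mult)
  fix h
  assume "h \<in> smooth_products"
  then show "\<exists>h'\<in>smooth_products. \<forall>x. (h has_real_derivative h' x) (at x)"
  proof induction
    case (mult f g)
    have "(\<lambda>x. deriv f x * g x + deriv g x * f x) \<in> smooth_products"
      using mult by (intro smooth_products.intros smooth_fun_deriv)
    then show ?case
      using mult by (intro bexI) (auto intro!: DERIV_mult smooth_fun_DERIV_0)
  next
    case (add f g)
    then obtain f' g' where "f' \<in> smooth_products" "\<And>x. (f has_real_derivative f' x) (at x)"
        "g' \<in> smooth_products" "\<And>x. (g has_real_derivative g' x) (at x)"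
      by blast
    then show ?case
      by (intro bexI[of _ "\<lambda>x. f' x + g' x"]) (auto intro: smooth_products.add DERIV_add)
  qed
qed

text \<open>For \<open>p = 1\<close> this is the classical smooth function that is flat at the
  origin; the polynomial factor in \<open>1 / x\<close> makes the family closed under
  differentiation.\<close>

definition flat_poly :: "real poly \<Rightarrow> real \<Rightarrow> real" where
  "flat_poly p x = (if x > 0 then poly p (1 / x) * exp (- (1 / x)) else 0)"

lemma poly_times_exp_minus_tendsto_0: "((\<lambda>y. poly p y * exp (- y)) \<longlongrightarrow> 0) at_top" for p :: "real poly"
proof -
  have "((\<lambda>y. \<Sum>i\<le>degree p. coeff p i * (y ^ i / exp y)) \<longlongrightarrow> (\<Sum>i\<le>degree p. coeff p i * 0)) at_top"
    by (intro tendsto_intros tendsto_power_div_exp_0)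
  then show ?thesis
    by (simp add: poly_altdef sum_distrib_right exp_minus divide_inverse mult.assoc)
qed

text \<open>With \<open>y = 1 / x\<close>, the chain rule contributes \<open>- y ^ 2\<close> and
  acts on \<open>poly p y * exp (- y)\<close>, whence the polynomial
  \<open>y ^ 2 * (p - p')\<close>. At the origin the exponential decay beats every polynomial in
  \<open>y\<close>.\<close>

lemma flat_poly_has_derivative:
  "(flat_poly p has_real_derivative flat_poly (monom 1 2 * (p - pderiv p)) x) (at x)"
proof (cases x "0 :: real" rule: linorder_cases)
  case less
  have "((\<lambda>x. 0) has_real_derivative 0) (at x)"
    by simp
  then have "(flat_poly p has_real_derivative 0) (at x)"
    by (rule has_field_derivative_transform_within_open[of _ _ _ "{..<0}"])
      (use less in \<open>auto simp: flat_poly_def\<close>)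
  then show ?thesis
    using less by (simp add: flat_poly_def)
next
  case greater
  have "((\<lambda>x. poly p (1 / x) * exp (- (1 / x))) has_real_derivative
      flat_poly (monom 1 2 * (p - pderiv p)) x) (at x)"
    using greater by (auto intro!: derivative_eq_intros DERIV_chain2[OF poly_DERIV]
        simp: flat_poly_def poly_monom field_simps power2_eq_square)
  then show ?thesis
    by (rule has_field_derivative_transform_within_open[of _ _ _ "{0<..}"])
      (use greater in \<open>auto simp: flat_poly_def\<close>)
next
  case equal
  have "((\<lambda>h. flat_poly p h / h) \<longlongrightarrow> 0) (at 0)"
  proof (rule filterlim_split_at)
    show "((\<lambda>h. flat_poly p h / h) \<longlongrightarrow> 0) (at_left 0)"
      by (rule tendsto_eventually) (auto simp: eventually_at_filter flat_poly_def)
    \<comment> \<open>\<open>pCons 0 p\<close> is \<open>p\<close> times the variable; it absorbs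
      the factor \<open>1 / h\<close> of the difference quotient.\<close>
    have "((\<lambda>h. poly (pCons 0 p) (inverse h) * exp (- inverse h)) \<longlongrightarrow> 0) (at_right (0 :: real))"
      by (rule filterlim_compose[OF poly_times_exp_minus_tendsto_0 filterlim_inverse_at_top_right])
    then show "((\<lambda>h. flat_poly p h / h) \<longlongrightarrow> 0) (at_right 0)"
      by (rule Lim_transform_eventually)
        (auto simp: eventually_at_filter flat_poly_def field_simps)
  qed
  then show ?thesis
    using equal by (simp add: has_field_derivative_iff flat_poly_def)
qed

lemma smooth_fun_flat_poly: "smooth_fun (flat_poly p)"
  by (rule smooth_fun_coinduct[of _ "range flat_poly"]) (auto intro: flat_poly_has_derivative)

section \<open>Test functions: closure properties and bump functions\<close>

lemma test_fun_iff: "test_fun f \<longleftrightarrow> smooth_fun f \<and> (\<exists>R. \<forall>s. f s \<noteq> 0 \<longrightarrow> \<bar>s\<bar> \<le> R)"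
  by (simp add: test_fun_def bounded_iff)

lemma test_fun_smooth: "test_fun f \<Longrightarrow> smooth_fun f"
  by (simp add: test_fun_def)

lemma test_fun_deriv:
  assumes "test_fun f"
  shows "test_fun (deriv f)"
proof -
  obtain R where R: "\<And>s. f s \<noteq> 0 \<Longrightarrow> \<bar>s\<bar> \<le> R"
    using assms test_fun_iff by blast
  have "deriv f s = 0" if "\<bar>s\<bar> > R" for s
  proof -
    have "((\<lambda>s. 0) has_real_derivative 0) (at s)"
      by simp
    then have "(f has_real_derivative 0) (at s)"
      by (rule has_field_derivative_transform_within_open[of _ _ _ "{s. R < \<bar>s\<bar>}"])
        (use R that in \<open>force intro!: open_Collect_less continuous_intros\<close>)+
    then show ?thesis
      by (rule DERIV_imp_deriv)
  qed
  then have "\<bar>s\<bar> \<le> R" if "deriv f s \<noteq> 0" for s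
    using that by force
  then show ?thesis
    using assms smooth_fun_deriv test_fun_iff by blast
qed

lemma test_fun_funpow_deriv: "test_fun f \<Longrightarrow> test_fun ((deriv ^^ n) f)"
  by (induction n) (auto intro: test_fun_deriv)

lemma test_fun_scale: "test_fun f \<Longrightarrow> test_fun (\<lambda>s. c * f s)"
  by (auto simp: test_fun_iff smooth_fun_scale)

lemma test_fun_add:
  assumes "test_fun f" "test_fun g"
  shows "test_fun (\<lambda>s. f s + g s)"
proof -
  obtain R R' where R: "\<And>s. f s \<noteq> 0 \<Longrightarrow> \<bar>s\<bar> \<le> R" "\<And>s. g s \<noteq> 0 \<Longrightarrow> \<bar>s\<bar> \<le> R'"
    using assms test_fun_iff by metis
  have "\<bar>s\<bar> \<le> max R R'" if "f s + g s \<noteq> 0" for s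
    using R[of s] that by (cases "f s = 0") auto
  then show ?thesis
    using assms smooth_fun_add test_fun_iff by blast
qed

lemma test_fun_shift:
  assumes "test_fun f"
  shows "test_fun (\<lambda>s. f (s + h))"
proof -
  obtain R where R: "\<And>s. f s \<noteq> 0 \<Longrightarrow> \<bar>s\<bar> \<le> R"
    using assms test_fun_iff by blast
  have "\<bar>s\<bar> \<le> R + \<bar>h\<bar>" if "f (s + h) \<noteq> 0" for s
    using R[OF that] by linarith
  then show ?thesis
    using assms smooth_fun_shift test_fun_iff by blast
qed

lemma test_fun_bounded:
  assumes "test_fun f"
  obtains M where "M \<ge> 0" "\<And>s. \<bar>f s\<bar> \<le> M"
proof -
  obtain R where R: "\<And>s. f s \<noteq> 0 \<Longrightarrow> \<bar>s\<bar> \<le> R"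
    using assms test_fun_iff by blast
  have "bounded (f ` {-R..R})"
    by (intro compact_imp_bounded compact_continuous_image smooth_fun_continuous_on
        test_fun_smooth assms) auto
  then obtain M where M: "\<And>s. s \<in> {-R..R} \<Longrightarrow> \<bar>f s\<bar> \<le> M"
    unfolding bounded_iff real_norm_def by blast
  have "\<bar>f s\<bar> \<le> max M 0" for s
    using M[of s] R[of s] by (cases "f s = 0") (auto simp: abs_le_iff le_max_iff_disj)
  then show ?thesis
    by (intro that[of "max M 0"]) auto
qed

text \<open>Each factor has the shape \<open>exp (- 1 / (n * x))\<close> at positive distance
  \<open>x\<close> from its endpoint, so growing \<open>n\<close> drives the product to 1 inside the
  interval while it stays zero outside.\<close>

definition bump :: "real \<Rightarrow> real \<Rightarrow> nat \<Rightarrow> real \<Rightarrow> real" where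
  "bump a b n s = flat_poly 1 (real n * (s - a)) * flat_poly 1 (real n * (b - s))"

lemma bump_bounds:
  "0 \<le> bump a b n s" "bump a b n s \<le> 1" "s \<notin> {a<..<b} \<Longrightarrow> bump a b n s = 0"
proof -
  have flat: "0 \<le> flat_poly 1 x" "flat_poly 1 x \<le> 1" for x
    by (auto simp: flat_poly_def)
  show "0 \<le> bump a b n s" "bump a b n s \<le> 1"
    by (auto simp: bump_def flat intro: mult_le_one)
  show "bump a b n s = 0" if "s \<notin> {a<..<b}"
    using that by (auto simp: bump_def flat_poly_def zero_less_mult_iff)
qed

lemma test_fun_bump: "test_fun (bump a b n)"
proof -
  have "smooth_fun (\<lambda>s. (1 * flat_poly 1 (real n * s + - (real n * a))) *
      (1 * flat_poly 1 (- real n * s + real n * b)))"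
    by (intro smooth_fun_mult smooth_fun_affine smooth_fun_flat_poly)
  also have "(\<lambda>s. (1 * flat_poly 1 (real n * s + - (real n * a))) *
      (1 * flat_poly 1 (- real n * s + real n * b))) = bump a b n"
    by (auto simp: bump_def algebra_simps)
  finally have "smooth_fun (bump a b n)" .
  moreover have "\<bar>s\<bar> \<le> max \<bar>a\<bar> \<bar>b\<bar>" if "bump a b n s \<noteq> 0" for s
  proof -
    have "s \<in> {a<..<b}"
      using that bump_bounds(3) by blast
    then show ?thesis
      by auto
  qed
  ultimately show ?thesis
    using test_fun_iff by blast
qed

lemma bump_tendsto: "(\<lambda>n. bump a b n s) \<longlonglongrightarrow> indicator {a<..<b} s"
proof (cases "s \<in> {a<..<b}")
  case True
  have flat: "(\<lambda>n. flat_poly 1 (real n * x)) \<longlonglongrightarrow> 1" if "x > 0" for x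
  proof -
    have "(\<lambda>n. exp (- (inverse (real n) * inverse x))) \<longlonglongrightarrow> exp (- (0 * inverse x))"
      by (intro tendsto_intros lim_inverse_n)
    then have "(\<lambda>n. exp (- (inverse (real n) * inverse x))) \<longlonglongrightarrow> 1"
      by simp
    then show ?thesis
      by (rule Lim_transform_eventually)
        (use that in \<open>auto intro!: eventually_mono[OF eventually_gt_at_top[of 0]]
          simp: flat_poly_def divide_inverse\<close>)
  qed
  have "(\<lambda>n. bump a b n s) \<longlonglongrightarrow> 1 * 1"
    unfolding bump_def using True by (intro tendsto_mult flat) auto
  then show ?thesis
    using True by simp
qed (simp add: bump_bounds(3))

section \<open>Translations and finite differences\<close>

lemma in_L2_bounded_support:
  assumes [measurable]: "f \<in> borel_measurable borel"
    and C: "\<And>s. \<bar>f s\<bar> \<le> C" and R: "\<And>s. f s \<noteq> 0 \<Longrightarrow> \<bar>s\<bar> \<le> R"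
  shows "in_L2 f"
  unfolding in_L2_def
proof
  show "integrable lborel (\<lambda>s. (f s)\<^sup>2)"
  proof (rule Bochner_Integration.integrable_bound)
    show "integrable lborel (\<lambda>s. C\<^sup>2 * indicator {-R..R} s :: real)"
      by (intro integrable_mult_right integrable_real_indicator) (auto simp: emeasure_lborel_Icc_eq)
    have "(f s)\<^sup>2 \<le> C\<^sup>2 * indicator {-R..R} s" for s
    proof (cases "f s = 0")
      case False
      then have "s \<in> {-R..R}"
        using R[of s] by (auto simp: abs_le_iff)
      then show ?thesis
        using power_mono[OF C[of s] abs_ge_zero, of 2] by simp
    qed simp
    then show "AE s in lborel. norm ((f s)\<^sup>2) \<le> norm (C\<^sup>2 * indicator {-R..R} s :: real)"
      by simp
  qed measurable
qed simp

lemma test_fun_in_L2: "test_fun f \<Longrightarrow> in_L2 f"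
  by (metis in_L2_bounded_support smooth_fun_measurable test_fun_bounded test_fun_iff)

text \<open>Dominated convergence for the squared differences with majorant the square of
  \<open>w\<close>. It serves the finite differences and each stage of the density proof.\<close>

lemma abs_l2_tendsto_dominated:
  assumes f: "\<And>n. in_L2 (f n)" and g: "in_L2 g" and w: "in_L2 w"
    and le: "\<And>n s. \<bar>f n s - g s\<bar> \<le> w s" and lim: "\<And>s. (\<lambda>n. f n s) \<longlonglongrightarrow> g s"
  shows "(\<lambda>n. abs_l2 (f n)) \<longlonglongrightarrow> abs_l2 g"
proof -
  have "(\<lambda>n. LINT s|lborel. (f n s - g s)\<^sup>2) \<longlonglongrightarrow> (LINT s|(lborel :: real measure). 0)"
  proof (rule integral_dominated_convergence)
    show "integrable lborel (\<lambda>s. (w s)\<^sup>2)"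
      by (rule in_L2_integrable[OF w])
    show "(\<lambda>s. (f n s - g s)\<^sup>2) \<in> borel_measurable lborel" for n
      using in_L2_integrable[OF in_L2_diff[OF f g]] by (rule borel_measurable_integrable)
    have "(\<lambda>n. (f n s - g s)\<^sup>2) \<longlonglongrightarrow> (g s - g s)\<^sup>2" for s
      by (intro tendsto_intros lim)
    then show "AE s in lborel. (\<lambda>n. (f n s - g s)\<^sup>2) \<longlonglongrightarrow> 0"
      by simp
    show "AE s in lborel. norm ((f n s - g s)\<^sup>2) \<le> (w s)\<^sup>2" for n
      using power_mono[OF le abs_ge_zero, of n _ 2] by simp
  qed simp
  then have "(\<lambda>n. sqrt (LINT s|lborel. (f n s - g s)\<^sup>2)) \<longlonglongrightarrow> sqrt 0"
    by (intro tendsto_real_sqrt) simp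
  then have "(\<lambda>n. norm (abs_l2 (f n) - abs_l2 g)) \<longlonglongrightarrow> 0"
    by (simp add: norm_abs_l2_diff f g L2_norm_def)
  then show ?thesis
    using tendsto_norm_zero_iff Lim_null by blast
qed

section \<open>Translations as isometries of \<open>l2\<close>, and their difference
  operators\<close>

lemma in_L2_shift:
  assumes "in_L2 f"
  shows "in_L2 (\<lambda>s. f (s + h))"
  using lborel_integrable_real_affine[OF in_L2_integrable[OF assms], of 1 h] in_L2_measurable[OF assms]
  by (simp add: in_L2_def add.commute)

lemma integral_shift: "(LINT s|lborel. f (s + h)) = (LINT s|lborel. f s)" for f :: "real \<Rightarrow> real"
  using lborel_integral_real_affine[of 1 f h] by (simp add: add.commute)

lift_definition l2_shift :: "real \<Rightarrow> l2 \<Rightarrow> l2" is "\<lambda>h f s. f (s + h)"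
proof -
  fix h f g
  assume fg: "l2_rel f g"
  then have "Measurable.pred borel (\<lambda>s. f s = g s)"
    by (auto simp: l2_rel_def in_L2_def)
  then have "AE s in lborel. f (h + 1 * s) = g (h + 1 * s)"
    using fg by (intro AE_borel_affine[where P = "\<lambda>s. f s = g s"]) (auto simp: l2_rel_def)
  then show "l2_rel (\<lambda>s. f (s + h)) (\<lambda>s. g (s + h))"
    using fg by (simp add: l2_rel_def in_L2_shift add.commute)
qed

lemma l2_shift_abs: "in_L2 f \<Longrightarrow> l2_shift h (abs_l2 f) = abs_l2 (\<lambda>s. f (s + h))"
  by (simp add: l2_shift.abs_eq l2_rel_def)

lemma l2_shift_shift: "l2_shift h (l2_shift k x) = l2_shift (h + k) x"
  by transfer (simp add: l2_rel_def in_L2_shift add.assoc)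

lemma l2_shift_add: "l2_shift h (x + y) = l2_shift h x + l2_shift h y"
  by transfer (simp add: l2_rel_def in_L2_shift in_L2_add)

lemma l2_shift_diff: "l2_shift h (x - y) = l2_shift h x - l2_shift h y"
  by transfer (simp add: l2_rel_def in_L2_shift in_L2_diff)

lemma l2_shift_scale: "l2_shift h (c *\<^sub>R x) = c *\<^sub>R l2_shift h x"
  by transfer (simp add: l2_rel_def in_L2_shift in_L2_scale)

lemma inner_l2_shift: "inner (l2_shift h x) y = inner x (l2_shift (- h) y)"
proof transfer
  fix h :: real and f g :: "real \<Rightarrow> real"
  show "(LINT s|lborel. f (s + h) * g s) = (LINT s|lborel. f s * g (s + - h))"
    using integral_shift[of "\<lambda>s. f s * g (s - h)" h] by simp
qed

lemma l2_shift_0: "l2_shift 0 x = x"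
  by transfer (simp add: l2_rel_def)

lemma norm_l2_shift: "norm (l2_shift h x) = norm x"
  by (simp add: norm_eq_sqrt_inner inner_l2_shift l2_shift_shift l2_shift_0)

lemma bounded_linear_l2_shift: "bounded_linear (l2_shift h)"
  by (intro bounded_linear_intro[of _ 1]) (auto simp: l2_shift_add l2_shift_scale norm_l2_shift)

text \<open>Centred differences are skew because the adjoint of a translation is the opposite
  translation, and they commute because translations do. Two step lengths supply the two
  coefficients needed to match a first and a third derivative.\<close>

definition difference_op :: "real \<Rightarrow> real \<Rightarrow> real \<Rightarrow> l2 \<Rightarrow> l2" where
  "difference_op p q h x =
     p *\<^sub>R (l2_shift h x - l2_shift (- h) x) + q *\<^sub>R (l2_shift (2 * h) x - l2_shift (- (2 * h)) x)"

lemma bounded_linear_difference_op: "bounded_linear (difference_op p q h)"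
  unfolding difference_op_def
  by (intro bounded_linear_add bounded_linear_const_scaleR bounded_linear_sub bounded_linear_l2_shift)

lemma difference_op_skew: "inner (difference_op p q h x) y = - inner x (difference_op p q h y)"
  by (simp add: difference_op_def inner_add_left inner_add_right inner_diff_left inner_diff_right
      inner_l2_shift algebra_simps)

lemma difference_op_commute:
  "difference_op p q h (difference_op p' q' h' x) = difference_op p' q' h' (difference_op p q h x)"
  by (simp add: difference_op_def l2_shift_diff l2_shift_add l2_shift_scale l2_shift_shift algebra_simps)

lemma difference_op_abs:
  assumes "in_L2 f"
  shows "difference_op p q h (abs_l2 f) =
    abs_l2 (\<lambda>s. p * (f (s + h) - f (s - h)) + q * (f (s + 2 * h) - f (s - 2 * h)))"
proof -
  have "in_L2 (\<lambda>s. f (s - k))" for k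
    using in_L2_shift[OF assms, of "- k"] by simp
  then show ?thesis
    using assms in_L2_shift[OF assms]
    by (simp add: difference_op_def l2_shift_abs abs_l2_diff abs_l2_scale abs_l2_add
        in_L2_scale in_L2_diff)
qed

lemma test_fun_difference:
  assumes "test_fun f"
  shows "test_fun (\<lambda>s. p * (f (s + h) - f (s - h)) + q * (f (s + 2 * h) - f (s - 2 * h)))"
proof -
  have "test_fun (\<lambda>s. p * f (s + h) + (- p) * f (s + - h) + (q * f (s + 2 * h) + (- q) * f (s + - (2 * h))))"
    by (intro test_fun_add test_fun_scale test_fun_shift assms)
  then show ?thesis
    by (simp add: algebra_simps)
qed

lemma taylor_bound:
  assumes "smooth_fun f" and M: "\<And>s. \<bar>(deriv ^^ 4) f s\<bar> \<le> M"
  shows "\<bar>f (s + x) - (f s + deriv f s * x + (deriv ^^ 2) f s / 2 * x ^ 2 + (deriv ^^ 3) f s / 6 * x ^ 3)\<bar>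
           \<le> M * x ^ 4"
proof -
  have "((\<lambda>x. (deriv ^^ m) f (s + x)) has_real_derivative (deriv ^^ Suc m) f (s + y)) (at y)" for m y
  proof -
    have "((\<lambda>x. s + x) has_real_derivative 1) (at y)"
      by (auto intro!: derivative_eq_intros)
    from DERIV_chain2[OF smooth_fun_DERIV[OF assms(1)] this] show ?thesis
      by (simp del: funpow.simps)
  qed
  then obtain t where "f (s + x) = (\<Sum>m<4. (deriv ^^ m) f (s + 0) / fact m * x ^ m) + (deriv ^^ 4) f (s + t) / fact 4 * x ^ 4"
    using Maclaurin_all_le[of "\<lambda>m x. (deriv ^^ m) f (s + x)" "\<lambda>x. f (s + x)" x 4] by auto
  then have "f (s + x) - (f s + deriv f s * x + (deriv ^^ 2) f s / 2 * x ^ 2 + (deriv ^^ 3) f s / 6 * x ^ 3)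
      = (deriv ^^ 4) f (s + t) / 24 * x ^ 4"
    by (simp add: eval_nat_numeral fact_numeral)
  moreover have "\<bar>(deriv ^^ 4) f (s + t) / 24 * x ^ 4\<bar> \<le> M * x ^ 4"
  proof -
    have "\<bar>(deriv ^^ 4) f (s + t) / 24\<bar> \<le> M"
      using M[of "s + t"] by (simp add: abs_divide)
    then show ?thesis
      using mult_right_mono[of "\<bar>(deriv ^^ 4) f (s + t) / 24\<bar>" M "x ^ 4"] by (simp add: abs_mult)
  qed
  ultimately show ?thesis
    by (simp only:)
qed

text \<open>The choice of \<open>p\<close> and \<open>q\<close> makes the coefficient of the first
  derivative exactly \<open>- a\<close>; that of the third is \<open>- b\<close> up to
  \<open>- a * h ^ 2 / 6\<close>, the source of the \<open>M3\<close> term. Remainders of order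
  \<open>h ^ 4\<close> meet coefficients of order \<open>1 / h ^ 3\<close>, which is why Taylor
  expansion to fourth order suffices; the constant 18 is 2 from step \<open>h\<close> plus 16 from
  step \<open>2 * h\<close>.\<close>

lemma difference_error:
  fixes a b h s :: real
  assumes f: "smooth_fun f" and M3: "\<And>s. \<bar>(deriv ^^ 3) f s\<bar> \<le> M3" and M4: "\<And>s. \<bar>(deriv ^^ 4) f s\<bar> \<le> M4"
    and h: "0 < h" "h \<le> 1"
  defines "p \<equiv> - a / (2 * h) + b / h ^ 3" and "q \<equiv> - b / (2 * h ^ 3)"
  shows "\<bar>p * (f (s + h) - f (s - h)) + q * (f (s + 2 * h) - f (s - 2 * h)) - (- a * deriv f s - b * (deriv ^^ 3) f s)\<bar>
    \<le> (\<bar>a\<bar> * M3 + \<bar>a\<bar> * M4 + 18 * \<bar>b\<bar> * M4) * h"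
proof -
  define r where "r x = f (s + x) - (f s + deriv f s * x + (deriv ^^ 2) f s / 2 * x ^ 2 + (deriv ^^ 3) f s / 6 * x ^ 3)" for x
  have r: "\<bar>r x\<bar> \<le> M4 * x ^ 4" for x
    unfolding r_def by (rule taylor_bound[OF f M4])
  have "M3 \<ge> 0" "M4 \<ge> 0"
    using M3[of 0] M4[of 0] by linarith+
  have "f (s + h) - f (s - h) = 2 * h * deriv f s + h ^ 3 / 3 * (deriv ^^ 3) f s + (r h - r (- h))"
    by (simp add: r_def algebra_simps)
  moreover have "f (s + 2 * h) - f (s - 2 * h) =
      4 * h * deriv f s + 8 * h ^ 3 / 3 * (deriv ^^ 3) f s + (r (2 * h) - r (- (2 * h)))"
    by (simp add: r_def algebra_simps)
  moreover have "p * (2 * h * d1 + h ^ 3 / 3 * d3 + e1) + q * (4 * h * d1 + 8 * h ^ 3 / 3 * d3 + e2) - (- a * d1 - b * d3)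
      = - a * h ^ 2 / 6 * d3 + p * e1 + q * e2" for d1 d3 e1 e2
    using h(1) by (simp add: p_def q_def field_simps power2_eq_square power3_eq_cube)
  ultimately have "p * (f (s + h) - f (s - h)) + q * (f (s + 2 * h) - f (s - 2 * h)) - (- a * deriv f s - b * (deriv ^^ 3) f s)
      = - a * h ^ 2 / 6 * (deriv ^^ 3) f s + p * (r h - r (- h)) + q * (r (2 * h) - r (- (2 * h)))"
    by simp
  moreover have "\<bar>- a * h ^ 2 / 6 * (deriv ^^ 3) f s\<bar> \<le> \<bar>a\<bar> * M3 * h"
  proof -
    have "\<bar>- a * h ^ 2 / 6 * (deriv ^^ 3) f s\<bar> = \<bar>a\<bar> * \<bar>(deriv ^^ 3) f s\<bar> * (h ^ 2 / 6)"
      by (simp add: abs_mult abs_divide)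
    also have "\<dots> \<le> \<bar>a\<bar> * M3 * h"
      using h M3[of s] \<open>M3 \<ge> 0\<close> mult_left_mono[of h 1 h]
      by (intro mult_mono) (auto simp: power2_eq_square)
    finally show ?thesis .
  qed
  moreover have "\<bar>p * (r h - r (- h))\<bar> \<le> (\<bar>a\<bar> * M4 + 2 * \<bar>b\<bar> * M4) * h"
  proof -
    have "\<bar>p\<bar> \<le> \<bar>a\<bar> / (2 * h) + \<bar>b\<bar> / h ^ 3"
      using h abs_triangle_ineq[of "- a / (2 * h)" "b / h ^ 3"] by (simp add: p_def abs_divide abs_mult)
    moreover have "\<bar>r h - r (- h)\<bar> \<le> 2 * M4 * h ^ 4"
      using r[of h] r[of "- h"] by simp
    ultimately have "\<bar>p\<bar> * \<bar>r h - r (- h)\<bar> \<le> (\<bar>a\<bar> / (2 * h) + \<bar>b\<bar> / h ^ 3) * (2 * M4 * h ^ 4)"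
      using h by (intro mult_mono) auto
    also have "\<dots> = \<bar>a\<bar> * M4 * h ^ 3 + 2 * \<bar>b\<bar> * M4 * h"
      using h(1) by (simp add: field_simps eval_nat_numeral)
    also have "\<dots> \<le> \<bar>a\<bar> * M4 * h + 2 * \<bar>b\<bar> * M4 * h"
      using h \<open>M4 \<ge> 0\<close> power_decreasing[of 1 3 h] by (intro add_right_mono mult_left_mono) auto
    finally show ?thesis
      by (simp only: abs_mult distrib_right)
  qed
  moreover have "\<bar>q * (r (2 * h) - r (- (2 * h)))\<bar> \<le> 16 * \<bar>b\<bar> * M4 * h"
  proof -
    have "\<bar>r (2 * h) - r (- (2 * h))\<bar> \<le> 32 * M4 * h ^ 4"
      using r[of "2 * h"] r[of "- (2 * h)"] by (simp add: power_mult_distrib)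
    then have "\<bar>q\<bar> * \<bar>r (2 * h) - r (- (2 * h))\<bar> \<le> \<bar>b\<bar> / (2 * h ^ 3) * (32 * M4 * h ^ 4)"
      using h by (intro mult_mono) (auto simp: q_def abs_divide abs_mult)
    also have "\<dots> = 16 * \<bar>b\<bar> * M4 * h"
      using h(1) by (simp add: field_simps eval_nat_numeral)
    finally show ?thesis
      by (simp add: abs_mult)
  qed
  moreover have "(\<bar>a\<bar> * M3 + \<bar>a\<bar> * M4 + 18 * \<bar>b\<bar> * M4) * h
      = \<bar>a\<bar> * M3 * h + (\<bar>a\<bar> * M4 + 2 * \<bar>b\<bar> * M4) * h + 16 * \<bar>b\<bar> * M4 * h"
    by (simp add: algebra_simps)
  ultimately show ?thesis
    by linarith
qed

definition third_order_op :: "real \<Rightarrow> real \<Rightarrow> (real \<Rightarrow> real) \<Rightarrow> real \<Rightarrow> real" where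
  "third_order_op a b f s = - a * deriv f s - b * (deriv ^^ 3) f s"

lemma test_fun_third_order_op:
  assumes "test_fun f"
  shows "test_fun (third_order_op a b f)"
proof -
  have "test_fun (\<lambda>s. (- a) * deriv f s + (- b) * (deriv ^^ 3) f s)"
    by (intro test_fun_add test_fun_scale test_fun_deriv test_fun_funpow_deriv assms)
  then show ?thesis
    by (simp add: third_order_op_def[abs_def])
qed

text \<open>The coefficients are chosen so that the terms of order \<open>h\<close> and \<open>h ^ 3\<close> in the Taylor
  expansion of the two centred differences combine to \<open>third_order_op a b\<close>.\<close>

definition approx_op :: "real \<Rightarrow> real \<Rightarrow> nat \<Rightarrow> l2 \<Rightarrow> l2" where
  "approx_op a b n = (let h = 1 / real (Suc n) in
     difference_op (- a / (2 * h) + b / h ^ 3) (- b / (2 * h ^ 3)) h)"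

text \<open>The error is uniformly of order \<open>h n\<close> and supported in one interval for all
  \<open>n\<close>, and together these give convergence in \<open>l2\<close>.\<close>

lemma approx_op_tendsto:
  assumes f: "test_fun f"
  shows "(\<lambda>n. approx_op a b n (abs_l2 f)) \<longlonglongrightarrow> abs_l2 (third_order_op a b f)"
proof -
  define h where "h n = 1 / real (Suc n)" for n
  have h: "0 < h n" "h n \<le> 1" for n
    by (auto simp: h_def field_simps)
  define p where "p n = - a / (2 * h n) + b / h n ^ 3" for n
  define q where "q n = - b / (2 * h n ^ 3)" for n
  define F where "F n s = p n * (f (s + h n) - f (s - h n)) + q n * (f (s + 2 * h n) - f (s - 2 * h n))" for n s
  obtain M3 where M3: "\<And>s. \<bar>(deriv ^^ 3) f s\<bar> \<le> M3"
    using test_fun_bounded[OF test_fun_funpow_deriv[OF f]] by blast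
  obtain M4 where M4: "\<And>s. \<bar>(deriv ^^ 4) f s\<bar> \<le> M4"
    using test_fun_bounded[OF test_fun_funpow_deriv[OF f]] by blast
  define K where "K = \<bar>a\<bar> * M3 + \<bar>a\<bar> * M4 + 18 * \<bar>b\<bar> * M4"
  have "M3 \<ge> 0" "M4 \<ge> 0"
    using M3[of 0] M4[of 0] by linarith+
  then have "K \<ge> 0"
    by (simp add: K_def)
  have err: "\<bar>F n s - third_order_op a b f s\<bar> \<le> K * h n" for n s
    unfolding F_def p_def q_def K_def third_order_op_def
    using h by (intro difference_error test_fun_smooth f M3 M4)
  obtain R where R: "\<And>s. f s \<noteq> 0 \<Longrightarrow> \<bar>s\<bar> \<le> R"
    using f test_fun_iff by blast
  obtain R' where R': "\<And>s. third_order_op a b f s \<noteq> 0 \<Longrightarrow> \<bar>s\<bar> \<le> R'"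
    using test_fun_third_order_op[OF f] test_fun_iff by blast
  \<comment> \<open>The steps are at most 1, so the differences look no farther than distance 2 from
    \<open>s\<close>.\<close>
  define S where "S = max (R + 2) R'"
  have supp: "\<bar>s\<bar> \<le> S" if nonzero: "F n s - third_order_op a b f s \<noteq> 0" for n s
  proof (rule ccontr)
    assume S: "\<not> \<bar>s\<bar> \<le> S"
    have "f (s + k) = 0" if "\<bar>k\<bar> \<le> 2" for k
      using R[of "s + k"] S that unfolding S_def by linarith
    from this[of "h n"] this[of "- h n"] this[of "2 * h n"] this[of "- (2 * h n)"]
    have "F n s = 0"
      using h[of n] by (simp add: F_def)
    moreover have "third_order_op a b f s = 0"
      using R'[of s] S unfolding S_def by linarith
    ultimately show False
      using nonzero by simp
  qed
  have "(\<lambda>n. abs_l2 (F n)) \<longlonglongrightarrow> abs_l2 (third_order_op a b f)"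
  proof (rule abs_l2_tendsto_dominated)
    show "in_L2 (F n)" for n
      unfolding F_def by (intro test_fun_in_L2 test_fun_difference f)
    show "in_L2 (third_order_op a b f)"
      by (intro test_fun_in_L2 test_fun_third_order_op f)
    show "in_L2 (\<lambda>s. K * indicator {-S..S} s)"
      by (rule in_L2_bounded_support[of _ K S])
        (use \<open>K \<ge> 0\<close> in \<open>auto simp: indicator_def split: if_splits\<close>)
    show "\<bar>F n s - third_order_op a b f s\<bar> \<le> K * indicator {-S..S} s" for n s
    proof (cases "F n s - third_order_op a b f s = 0")
      case False
      have "K * h n \<le> K * 1"
        using h \<open>K \<ge> 0\<close> by (intro mult_left_mono) auto
      then show ?thesis
        using err[of n s] supp[OF False] by (auto simp: indicator_def abs_le_iff)
    qed (use \<open>K \<ge> 0\<close> in simp)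
    have h0: "h \<longlonglongrightarrow> 0"
      unfolding h_def using LIMSEQ_inverse_real_of_nat by (simp add: inverse_eq_divide)
    show "(\<lambda>n. F n s) \<longlonglongrightarrow> third_order_op a b f s" for s
    proof (rule Lim_null[THEN iffD2], rule Lim_null_comparison)
      show "(\<lambda>n. K * h n) \<longlonglongrightarrow> 0"
        using tendsto_mult[OF tendsto_const h0, of K] by simp
      show "\<forall>\<^sub>F n in sequentially. norm (F n s - third_order_op a b f s) \<le> K * h n"
        using err by simp
    qed
  qed
  moreover have "approx_op a b n (abs_l2 f) = abs_l2 (F n)" for n
    unfolding approx_op_def Let_def difference_op_abs[OF test_fun_in_L2[OF f]]
      F_def[abs_def] p_def q_def h_def ..
  ultimately show ?thesis
    by simp
qed

section \<open>Density of test functions\<close>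

definition test_space :: "l2 set" where
  "test_space = abs_l2 ` Collect test_fun"

lemma subspace_test_space: "subspace test_space"
proof (rule subspaceI)
  have "test_fun (\<lambda>s. 0)"
    by (auto simp: test_fun_iff smooth_fun_const)
  then show "0 \<in> test_space"
    by (auto simp: test_space_def zero_l2_def)
  fix x y c
  assume "x \<in> test_space"
  then obtain f where f: "test_fun f" "x = abs_l2 f"
    by (auto simp: test_space_def)
  then show "c *\<^sub>R x \<in> test_space"
    by (auto simp: test_space_def abs_l2_scale test_fun_in_L2 intro!: test_fun_scale)
  assume "y \<in> test_space"
  then obtain g where g: "test_fun g" "y = abs_l2 g"
    by (auto simp: test_space_def)
  with f show "x + y \<in> test_space"
    by (auto simp: test_space_def abs_l2_add test_fun_in_L2 intro!: test_fun_add)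
qed

abbreviation test_closure :: "l2 set" where
  "test_closure \<equiv> closure test_space"

lemma subspace_test_closure: "subspace test_closure"
proof (rule subspaceI)
  show "0 \<in> test_closure"
    using subspace_0[OF subspace_test_space] closure_subset by blast
  fix x y c
  assume "x \<in> test_closure"
  then obtain u where u: "\<And>n. u n \<in> test_space" "u \<longlonglongrightarrow> x"
    unfolding closure_sequential by blast
  have "\<forall>n. c *\<^sub>R u n \<in> test_space" "(\<lambda>n. c *\<^sub>R u n) \<longlonglongrightarrow> c *\<^sub>R x"
    by (auto intro!: subspace_mul[OF subspace_test_space] tendsto_intros u)
  then show "c *\<^sub>R x \<in> test_closure"
    unfolding closure_sequential by (intro exI conjI)
  assume "y \<in> test_closure"
  then obtain v where v: "\<And>n. v n \<in> test_space" "v \<longlonglongrightarrow> y"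
    unfolding closure_sequential by blast
  have "\<forall>n. u n + v n \<in> test_space" "(\<lambda>n. u n + v n) \<longlonglongrightarrow> x + y"
    by (auto intro!: subspace_add[OF subspace_test_space] tendsto_intros u v)
  then show "x + y \<in> test_closure"
    unfolding closure_sequential by (intro exI conjI)
qed

lemma test_closure_limit: "(\<And>n. x n \<in> test_closure) \<Longrightarrow> x \<longlonglongrightarrow> y \<Longrightarrow> y \<in> test_closure"
  using closed_sequentially[OF closed_closure] by blast

lemma in_L2_indicator:
  assumes "A \<in> sets borel"
  shows "in_L2 (indicator (A \<inter> {- real N<..<real N}))"
proof (rule in_L2_bounded_support[of _ 1 "real N"])
  show "indicator (A \<inter> {- real N<..<real N}) \<in> borel_measurable (borel :: real measure)"
    using assms by (intro borel_measurable_indicator) auto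
qed (auto simp: indicator_def split: if_splits)

lemma in_L2_indicator_interval: "in_L2 (indicator {a<..<b})"
  by (rule in_L2_bounded_support[of _ 1 "max \<bar>a\<bar> \<bar>b\<bar>"]) (auto simp: indicator_def split: if_splits)

lemma indicator_interval_in_test_closure: "abs_l2 (indicator {a<..<b}) \<in> test_closure"
proof (rule test_closure_limit)
  show "abs_l2 (bump a b n) \<in> test_closure" for n
    using closure_subset test_fun_bump unfolding test_space_def by fast
  show "(\<lambda>n. abs_l2 (bump a b n)) \<longlonglongrightarrow> abs_l2 (indicator {a<..<b})"
  proof (rule abs_l2_tendsto_dominated)
    show "\<bar>bump a b n s - indicator {a<..<b} s\<bar> \<le> indicator {a<..<b} s" for n s
      using bump_bounds(1,2)[of a b n s] bump_bounds(3)[of s a b n] by (auto simp: indicator_def)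
  qed (auto intro: test_fun_in_L2 test_fun_bump in_L2_indicator_interval bump_tendsto)
qed

text \<open>Dynkin argument from the intersection-stable generator of open intervals. Cutting by a
  bounded interval keeps every indicator in L2 and provides one majorant for the countable
  unions.\<close>

lemma indicator_in_test_closure:
  assumes "A \<in> sets borel"
  shows "abs_l2 (indicator (A \<inter> {- real N<..<real N})) \<in> test_closure"
proof -
  let ?G = "range (\<lambda>(a, b). {a<..<b :: real})" and ?I = "{- real N<..<real N}"
  have "borel = sigma UNIV ?G"
    using borel_eq_box[where ?'a = real] by (simp add: box_real(1))
  then have borel: "sets borel = sigma_sets UNIV ?G"
    by (metis Pow_UNIV sets_measure_of top_greatest)
  have "Int_stable ?G"
    unfolding Int_stable_def
  proof (intro ballI)
    fix A B
    assume "A \<in> ?G" "B \<in> ?G"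
    then obtain a b c d where "A = {a<..<b}" "B = {c<..<d}"
      by auto
    then have "A \<inter> B = (\<lambda>(a, b). {a<..<b}) (max a c, min b d)"
      by auto
    then show "A \<inter> B \<in> ?G"
      by blast
  qed
  moreover have "?G \<subseteq> Pow UNIV"
    by simp
  moreover have "A \<in> sigma_sets UNIV ?G"
    using assms borel by simp
  ultimately show ?thesis
  proof (induction rule: sigma_sets_induct_disjoint)
    case (basic A)
    then obtain a b where "A = {a<..<b}"
      by auto
    then have "A \<inter> ?I = {max a (- real N)<..<min b (real N)}"
      by auto
    then show ?case
      using indicator_interval_in_test_closure by simp
  next
    case empty
    then show ?case
      using indicator_interval_in_test_closure[of 0 0] by (simp add: indicator_def[abs_def])
  next
    case (compl A)
    then have A: "A \<in> sets borel"
      by (simp add: borel)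
    have "indicator ((UNIV - A) \<inter> ?I) = (\<lambda>s. indicator ?I s - indicator (A \<inter> ?I) s :: real)"
      by (auto simp: indicator_def)
    then have "abs_l2 (indicator ((UNIV - A) \<inter> ?I)) = abs_l2 (indicator ?I) - abs_l2 (indicator (A \<inter> ?I))"
      by (simp add: abs_l2_diff in_L2_indicator_interval in_L2_indicator[OF A])
    then show ?case
      using compl indicator_interval_in_test_closure
      by (simp add: subspace_diff[OF subspace_test_closure])
  next
    case (union A)
    then have A: "A i \<in> sets borel" for i
      by (auto simp: borel)
    have "abs_l2 (indicator ((\<Union>i<n. A i) \<inter> ?I)) \<in> test_closure" for n
    proof (induction n)
      case 0
      then show ?case
        using indicator_interval_in_test_closure[of 0 0] by (simp add: indicator_def[abs_def])
    next
      case (Suc n)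
      have "A i \<inter> A n = {}" if "i < n" for i
        using \<open>disjoint_family A\<close> that by (intro disjoint_family_onD) auto
      then have "indicator ((\<Union>i<Suc n. A i) \<inter> ?I) =
          (\<lambda>s. indicator ((\<Union>i<n. A i) \<inter> ?I) s + indicator (A n \<inter> ?I) s :: real)"
        by (fastforce simp: indicator_def lessThan_Suc)
      then have "abs_l2 (indicator ((\<Union>i<Suc n. A i) \<inter> ?I)) =
          abs_l2 (indicator ((\<Union>i<n. A i) \<inter> ?I)) + abs_l2 (indicator (A n \<inter> ?I))"
        using A by (subst abs_l2_add) (auto intro!: in_L2_indicator)
      then show ?case
        using Suc union by (simp add: subspace_add[OF subspace_test_closure])
    qed
    moreover have "(\<lambda>n. abs_l2 (indicator ((\<Union>i<n. A i) \<inter> ?I))) \<longlonglongrightarrow> abs_l2 (indicator ((\<Union>i. A i) \<inter> ?I))"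
    proof (rule abs_l2_tendsto_dominated)
      show "\<bar>indicator ((\<Union>i<n. A i) \<inter> ?I) s - indicator ((\<Union>i. A i) \<inter> ?I) s\<bar> \<le> (indicator ?I s :: real)" for n s
        by (auto simp: indicator_def)
      show "(\<lambda>n. indicator ((\<Union>i<n. A i) \<inter> ?I) s :: real) \<longlonglongrightarrow> indicator ((\<Union>i. A i) \<inter> ?I) s" for s
        unfolding indicator_inter_arith by (intro tendsto_intros LIMSEQ_indicator_UN)
    qed (use A in \<open>auto intro!: in_L2_indicator in_L2_indicator_interval\<close>)
    ultimately show ?case
      by (rule test_closure_limit)
  qed
qed

lemma sum_in_test_closure:
  assumes "finite T" "\<And>y. y \<in> T \<Longrightarrow> in_L2 (g y) \<and> abs_l2 (g y) \<in> test_closure"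
  shows "in_L2 (\<lambda>s. \<Sum>y\<in>T. g y s) \<and> abs_l2 (\<lambda>s. \<Sum>y\<in>T. g y s) \<in> test_closure"
  using assms
proof (induction T rule: finite_induct)
  case empty
  then show ?case
    using subspace_0[OF subspace_test_closure] by (simp add: in_L2_zero zero_l2_def)
next
  case (insert y T)
  then have "abs_l2 (\<lambda>s. \<Sum>y\<in>insert y T. g y s) = abs_l2 (g y) + abs_l2 (\<lambda>s. \<Sum>y\<in>T. g y s)"
    by (simp add: abs_l2_add)
  then show ?case
    using insert by (simp add: in_L2_add subspace_add[OF subspace_test_closure])
qed

lemma test_space_dense: "test_closure = UNIV"
proof -
  have "abs_l2 f \<in> test_closure" if f: "in_L2 f" for f
  proof -
    have "f \<in> borel_measurable borel"
      using f by (simp add: in_L2_def)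
    then obtain F where F: "\<And>n. simple_function borel (F n)" "\<And>s. (\<lambda>n. F n s) \<longlonglongrightarrow> f s"
        "\<And>n s. \<bar>F n s\<bar> \<le> 2 * \<bar>f s\<bar>"
      using borel_measurable_implies_sequence_metric[of f borel 0] by auto
    define I where "I n = {- real n<..<real n}" for n
    \<comment> \<open>The cut by \<open>I n\<close> is needed since level sets of
      \<open>F n\<close>, in particular the zero set, may have infinite measure.\<close>
    define G where "G n s = (\<Sum>y\<in>range (F n). y * indicator (F n -` {y} \<inter> I n) s)" for n s
    have G_eq: "G n s = F n s * indicator (I n) s" for n s
    proof -
      have "G n s = (\<Sum>y\<in>range (F n). if y = F n s then y * indicator (I n) s else 0)"
        unfolding G_def by (intro sum.cong) (auto simp: indicator_def)
      also have "\<dots> = F n s * indicator (I n) s"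
        using simple_functionD(1)[OF F(1), of n] by (simp add: sum.delta)
      finally show ?thesis .
    qed
    have G: "in_L2 (G n) \<and> abs_l2 (G n) \<in> test_closure" for n
      unfolding G_def
    proof (rule sum_in_test_closure)
      show "finite (range (F n))"
        using simple_functionD(1)[OF F(1)] by simp
      fix y
      have "F n -` {y} \<in> sets borel"
        using simple_functionD(2)[OF F(1), of n "{y}"] by simp
      then have "in_L2 (indicator (F n -` {y} \<inter> I n))" "abs_l2 (indicator (F n -` {y} \<inter> I n)) \<in> test_closure"
        unfolding I_def by (auto intro: in_L2_indicator indicator_in_test_closure)
      then show "in_L2 (\<lambda>s. y * indicator (F n -` {y} \<inter> I n) s) \<and>
          abs_l2 (\<lambda>s. y * indicator (F n -` {y} \<inter> I n) s) \<in> test_closure"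
        by (simp add: in_L2_scale subspace_mul[OF subspace_test_closure] flip: abs_l2_scale)
    qed
    show ?thesis
    proof (rule test_closure_limit)
      show "abs_l2 (G n) \<in> test_closure" for n
        using G by blast
      show "(\<lambda>n. abs_l2 (G n)) \<longlonglongrightarrow> abs_l2 f"
      proof (rule abs_l2_tendsto_dominated)
        have "in_L2 (\<lambda>s. \<bar>f s\<bar>)"
          using f by (auto simp: in_L2_def intro: borel_measurable_abs)
        \<comment> \<open>The 3 is the factor 2 in the bound on \<open>F n\<close> plus one more for
          \<open>f\<close> itself.\<close>
        then show "in_L2 (\<lambda>s. 3 * \<bar>f s\<bar>)"
          by (rule in_L2_scale)
        show "\<bar>G n s - f s\<bar> \<le> 3 * \<bar>f s\<bar>" for n s
          using F(3)[of n s] by (auto simp: G_eq indicator_def)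
        show "(\<lambda>n. G n s) \<longlonglongrightarrow> f s" for s
        proof (rule Lim_transform_eventually[OF F(2)])
          show "\<forall>\<^sub>F n in sequentially. F n s = G n s"
          proof (rule eventually_sequentiallyI)
            fix n
            assume "nat \<lceil>\<bar>s\<bar>\<rceil> + 1 \<le> n"
            then have "\<bar>s\<bar> < real n"
              by linarith
            then show "F n s = G n s"
              by (auto simp: G_eq I_def indicator_def)
          qed
        qed
      qed (use f G in auto)
    qed
  qed
  from this[OF in_L2_rep] show ?thesis
    by (auto simp: abs_rep_l2)
qed

section \<open>The linear evolution\<close>

text \<open>The limit exists on \<open>test_space\<close>; elsewhere the value may be junk.\<close>

definition third_order_l2 :: "real \<Rightarrow> real \<Rightarrow> l2 \<Rightarrow> l2" where
  "third_order_l2 a b x = lim (\<lambda>n. approx_op a b n x)"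

lemma third_order_l2_abs: "test_fun f \<Longrightarrow> third_order_l2 a b (abs_l2 f) = abs_l2 (third_order_op a b f)"
  unfolding third_order_l2_def by (rule limI[OF approx_op_tendsto])

lemma skew_approximation_approx_op: "skew_approximation (approx_op a b) test_space (third_order_l2 a b)"
proof (rule skew_approximation.intro)
  show "bounded_linear (approx_op a b n)" for n
    by (simp add: approx_op_def Let_def bounded_linear_difference_op)
  show "inner (approx_op a b n x) y = - inner x (approx_op a b n y)" for n x y
    by (simp add: approx_op_def Let_def difference_op_skew)
  show "approx_op a b m (approx_op a b n x) = approx_op a b n (approx_op a b m x)" for m n x
    by (simp only: approx_op_def Let_def difference_op_commute)
  show "subspace test_space"
    by (rule subspace_test_space)
  show "test_closure = UNIV"
    by (rule test_space_dense)
  fix z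
  assume "z \<in> test_space"
  then obtain f where f: "test_fun f" "z = abs_l2 f"
    by (auto simp: test_space_def)
  show "approx_op a b n z \<in> test_space" for n
    unfolding f(2) approx_op_def Let_def difference_op_abs[OF test_fun_in_L2[OF f(1)]] test_space_def
    by (intro imageI CollectI test_fun_difference f(1))
  show "(\<lambda>n. approx_op a b n z) \<longlonglongrightarrow> third_order_l2 a b z"
    using approx_op_tendsto[OF f(1)] f by (simp add: third_order_l2_abs)
qed

interpretation third_order: skew_approximation "approx_op a b" test_space "third_order_l2 a b" for a b
  by (rule skew_approximation_approx_op)

lemma test_space_abs: "test_fun f \<Longrightarrow> abs_l2 f \<in> test_space"
  by (auto simp: test_space_def)

lemma third_order_op_uminus: "third_order_op (- a) (- b) f = (\<lambda>s. - third_order_op a b f s)"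
  by (auto simp: third_order_op_def)

text \<open>Obtained from the skewness of the finite differences in the limit: the adjoint is the
  negated operator, that is, the one with both coefficients negated.\<close>

lemma formal_adjoint_third_order_op: "formal_adjoint (third_order_op a b) (third_order_op (- a) (- b))"
  unfolding formal_adjoint_def
proof (intro allI impI conjI)
  fix f g
  assume g: "test_fun g"
  show "test_fun (third_order_op (- a) (- b) g)"
    by (rule test_fun_third_order_op[OF g])
  assume f: "test_fun f"
  note L2 = test_fun_in_L2[OF f] test_fun_in_L2[OF g]
    test_fun_in_L2[OF test_fun_third_order_op[OF f]] test_fun_in_L2[OF test_fun_third_order_op[OF g]]
  show "integrable lborel (\<lambda>s. third_order_op a b f s * g s)"
    by (intro in_L2_integrable_mult L2)
  have "inner (abs_l2 (third_order_op a b f)) (abs_l2 g) = - inner (abs_l2 f) (abs_l2 (third_order_op a b g))"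
    using third_order.L_skew[of "abs_l2 f" "abs_l2 g" a b] f g
    by (simp add: third_order_l2_abs test_space_abs)
  then show "(LINT s|lborel. third_order_op a b f s * g s) = (LINT s|lborel. f s * third_order_op (- a) (- b) g s)"
    by (simp add: inner_abs_l2 L2 third_order_op_uminus)
qed

text \<open>The difference of \<open>B g\<close> and \<open>B' g\<close> is itself a test function;
  pairing it with itself gives zero. This tames the existential quantifier over the adjoint in
  \<open>weak_solution\<close>.\<close>

lemma formal_adjoint_unique:
  assumes B: "formal_adjoint A B" and B': "formal_adjoint A B'" and g: "test_fun g"
  shows "abs_l2 (B g) = abs_l2 (B' g)"
proof -
  have Bg: "test_fun (B g)" "test_fun (B' g)"
    using B B' g by (simp_all add: formal_adjoint_def)
  define f where "f = (\<lambda>s. B g s + (- 1) * B' g s)"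
  have f: "test_fun f"
    unfolding f_def by (intro test_fun_add test_fun_scale Bg)
  have "(LINT s|lborel. A f s * g s) = (LINT s|lborel. f s * B g s)"
    "(LINT s|lborel. A f s * g s) = (LINT s|lborel. f s * B' g s)"
    using B B' g f unfolding formal_adjoint_def by simp_all
  then have "(LINT s|lborel. f s * B g s) = (LINT s|lborel. f s * B' g s)"
    by simp
  then have "inner (abs_l2 f) (abs_l2 (B g) - abs_l2 (B' g)) = 0"
    by (simp add: inner_diff_right inner_abs_l2 test_fun_in_L2 f Bg)
  moreover have "abs_l2 (B g) - abs_l2 (B' g) = abs_l2 f"
    by (simp add: abs_l2_diff test_fun_in_L2 Bg f_def)
  ultimately show ?thesis
    by simp
qed

lemma inner_rep_abs_l2: "in_L2 f \<Longrightarrow> (LINT s|lborel. rep_l2 x s * f s) = inner x (abs_l2 f)"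
  using inner_abs_l2[OF in_L2_rep] by (simp add: abs_rep_l2)

text \<open>The representatives are chosen for each time separately. This is harmless, as
  \<open>weak_solution\<close> only speaks of null sets and integrals in \<open>s\<close> at fixed
  times.\<close>

lemma weak_solution_flow:
  assumes "in_L2 w0"
  shows "weak_solution (third_order_op a b) w0 (\<lambda>t. rep_l2 (third_order.flow a b t (abs_l2 w0)))"
  unfolding weak_solution_def
proof (intro conjI allI impI)
  let ?u = "\<lambda>t. third_order.flow a b t (abs_l2 w0)"
  show "in_L2 (rep_l2 (?u t))" for t
    by (rule in_L2_rep)
  show "((\<lambda>r. L2_norm (\<lambda>s. rep_l2 (?u r) s - rep_l2 (?u t) s)) \<longlongrightarrow> 0) (at t within {0..})" for t
  proof -
    have "(?u \<longlongrightarrow> ?u t) (at t within {0..})"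
      using third_order.continuous_flow[of a b "abs_l2 w0"]
      by (auto simp: continuous_on_def intro: tendsto_within_subset)
    then have "((\<lambda>r. norm (?u r - ?u t)) \<longlongrightarrow> 0) (at t within {0..})"
      using Lim_null tendsto_norm_zero by blast
    then show ?thesis
      by (simp add: norm_abs_l2_diff[OF in_L2_rep in_L2_rep, symmetric] abs_rep_l2)
  qed
  show "AE s in lborel. rep_l2 (?u 0) s = w0 s"
    by (simp add: third_order.flow_0 rep_abs_l2[OF assms])
  have der: "((\<lambda>r. LINT s|lborel. rep_l2 (?u r) s * g s) has_real_derivative
      (LINT s|lborel. rep_l2 (?u t) s * third_order_op (- a) (- b) g s)) (at t within {0..})"
    if g: "test_fun g" for g t
    using third_order.flow_weak_derivative[OF test_space_abs[OF g], of a b "abs_l2 w0" t] g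
    by (simp add: inner_rep_abs_l2 test_fun_in_L2 test_fun_third_order_op third_order_l2_abs
        third_order_op_uminus has_field_derivative_at_within)
  show "\<exists>B. formal_adjoint (third_order_op a b) B \<and> (\<forall>g. test_fun g \<longrightarrow> (\<forall>t\<ge>0.
      ((\<lambda>r. LINT s|lborel. rep_l2 (?u r) s * g s) has_real_derivative
        (LINT s|lborel. rep_l2 (?u t) s * B g s)) (at t within {0..})))"
    by (intro exI[of _ "third_order_op (- a) (- b)"] conjI formal_adjoint_third_order_op allI impI der)
qed

text \<open>The difference from the flow starts at zero and satisfies the weak equation, once the
  adjoint supplied with \<open>v\<close> is exchanged for the concrete one;
  \<open>weak_solution_zero\<close> then applies.\<close>

lemma weak_solution_eq_flow:
  assumes w0: "in_L2 w0" and v: "weak_solution (third_order_op a b) w0 v" and t: "t \<ge> 0"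
  shows "abs_l2 (v t) = third_order.flow a b t (abs_l2 w0)"
proof -
  let ?u = "\<lambda>t. third_order.flow a b t (abs_l2 w0)"
  have v_L2: "in_L2 (v t)" if "t \<ge> 0" for t
    using v that by (simp add: weak_solution_def)
  define d where "d t = abs_l2 (v t) - ?u t" for t
  have "d t = 0"
  proof (rule third_order.weak_solution_zero)
    have "continuous_on {0..} (\<lambda>t. abs_l2 (v t))"
      unfolding continuous_on_def
    proof
      fix t :: real
      assume t: "t \<in> {0..}"
      then have "((\<lambda>r. L2_norm (\<lambda>s. v r s - v t s)) \<longlongrightarrow> 0) (at t within {0..})"
        using v by (simp add: weak_solution_def)
      moreover have "\<forall>\<^sub>F r in at t within {0..}. L2_norm (\<lambda>s. v r s - v t s) = norm (abs_l2 (v r) - abs_l2 (v t))"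
        using t by (auto simp: eventually_at_filter norm_abs_l2_diff v_L2)
      ultimately have "((\<lambda>r. norm (abs_l2 (v r) - abs_l2 (v t))) \<longlongrightarrow> 0) (at t within {0..})"
        by (rule Lim_transform_eventually)
      then show "((\<lambda>t. abs_l2 (v t)) \<longlongrightarrow> abs_l2 (v t)) (at t within {0..})"
        using tendsto_norm_zero_iff Lim_null by blast
    qed
    then show "continuous_on {0..} d"
      unfolding d_def
      by (intro continuous_on_diff continuous_on_subset[OF third_order.continuous_flow]) auto
    have "AE s in lborel. v 0 s = w0 s"
      using v by (simp add: weak_solution_def)
    then show "d 0 = 0"
      by (simp add: d_def third_order.flow_0 abs_l2_eq_iff v_L2 w0)
    fix z and t :: real
    assume "z \<in> test_space" and t: "t \<ge> 0"
    then obtain g where g: "test_fun g" "z = abs_l2 g"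
      by (auto simp: test_space_def)
    obtain B where B: "formal_adjoint (third_order_op a b) B" and der:
        "((\<lambda>r. LINT s|lborel. v r s * g s) has_real_derivative (LINT s|lborel. v t s * B g s)) (at t within {0..})"
      using v g(1) t unfolding weak_solution_def by blast
    have "test_fun (B g)"
      using B g(1) by (simp add: formal_adjoint_def)
    then have "(LINT s|lborel. v t s * B g s) = inner (abs_l2 (v t)) (abs_l2 (B g))"
      by (simp add: inner_abs_l2 v_L2[OF t] test_fun_in_L2)
    also have "abs_l2 (B g) = abs_l2 (third_order_op (- a) (- b) g)"
      by (rule formal_adjoint_unique[OF B formal_adjoint_third_order_op g(1)])
    also have "\<dots> = - third_order_l2 a b z"
      using abs_l2_scale[OF test_fun_in_L2[OF test_fun_third_order_op[OF g(1)]], of "- 1" a b]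
      by (simp add: g third_order_l2_abs third_order_op_uminus)
    finally have der': "((\<lambda>r. LINT s|lborel. v r s * g s) has_real_derivative
        - inner (abs_l2 (v t)) (third_order_l2 a b z)) (at t within {0..})"
      using der by simp
    \<comment> \<open>For negative \<open>r\<close> nothing is known about \<open>v r\<close>, so
      integral and inner product are identified only within the half-line.\<close>
    have "((\<lambda>r. inner (abs_l2 (v r)) z) has_real_derivative
        - inner (abs_l2 (v t)) (third_order_l2 a b z)) (at t within {0..})"
      by (rule has_field_derivative_transform_within[OF der' zero_less_one])
        (use t in \<open>auto simp: g inner_abs_l2 v_L2 test_fun_in_L2\<close>)
    moreover have "((\<lambda>r. inner (?u r) z) has_real_derivative
        - inner (?u t) (third_order_l2 a b z)) (at t within {0..})"
      by (rule has_field_derivative_at_within[OF third_order.flow_weak_derivative[OF \<open>z \<in> test_space\<close>]])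
    ultimately have "((\<lambda>r. inner (abs_l2 (v r)) z - inner (?u r) z) has_real_derivative
        - inner (abs_l2 (v t)) (third_order_l2 a b z) - - inner (?u t) (third_order_l2 a b z)) (at t within {0..})"
      by (rule DERIV_diff)
    then show "((\<lambda>r. inner (d r) z) has_real_derivative - inner (d t) (third_order_l2 a b z)) (at t within {0..})"
      by (simp add: d_def inner_diff_left)
  qed (rule t)
  then show ?thesis
    by (simp add: d_def)
qed

lemma L2_stable_zero_third_order_op: "L2_stable_zero (third_order_op a b)"
  unfolding L2_stable_zero_def
proof (rule allI, rule impI)
  fix \<epsilon> :: real
  assume "\<epsilon> > 0"
  show "\<exists>\<delta>>0. \<forall>w0. in_L2 w0 \<and> L2_norm w0 < \<delta> \<longrightarrow> (\<exists>w. weak_solution (third_order_op a b) w0 w \<and>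
      (\<forall>v. weak_solution (third_order_op a b) w0 v \<longrightarrow> (\<forall>t\<ge>0. AE s in lborel. v t s = w t s)) \<and>
      (\<forall>t\<ge>0. L2_norm (w t) < \<epsilon>))"
  proof (rule exI[of _ \<epsilon>], rule conjI[OF \<open>\<epsilon> > 0\<close>], rule allI, rule impI, elim conjE)
    fix w0
    assume w0: "in_L2 w0" "L2_norm w0 < \<epsilon>"
    let ?w = "\<lambda>t. rep_l2 (third_order.flow a b t (abs_l2 w0))"
    have 1: "weak_solution (third_order_op a b) w0 ?w"
      by (rule weak_solution_flow[OF w0(1)])
    have 2: "AE s in lborel. v t s = ?w t s" if v: "weak_solution (third_order_op a b) w0 v" and "t \<ge> 0" for v t
    proof -
      have "in_L2 (v t)"
        using v \<open>t \<ge> 0\<close> by (simp add: weak_solution_def)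
      then show ?thesis
        using weak_solution_eq_flow[OF w0(1) v \<open>t \<ge> 0\<close>]
        by (subst abs_l2_eq_iff[symmetric]) (simp_all add: in_L2_rep abs_rep_l2)
    qed
    have 3: "L2_norm (?w t) < \<epsilon>" for t
      using w0 by (simp add: L2_norm_rep third_order.norm_flow norm_abs_l2)
    show "\<exists>w. weak_solution (third_order_op a b) w0 w \<and>
        (\<forall>v. weak_solution (third_order_op a b) w0 v \<longrightarrow> (\<forall>t\<ge>0. AE s in lborel. v t s = w t s)) \<and>
        (\<forall>t\<ge>0. L2_norm (w t) < \<epsilon>)"
      by (rule exI[of _ ?w]) (simp add: 1 2 3)
  qed
qed

section \<open>Linearization at a helix\<close>

text \<open>The second conclusion is Faa di Bruno's formula for the third derivative of a power.
  Positivity at \<open>x\<close> spreads to an open set by continuity, and there the nested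
  \<open>deriv\<close> can be replaced by explicit expressions.\<close>

lemma
  fixes u u1 u2 u3 :: "real \<Rightarrow> real"
  assumes u1: "\<And>x. (u has_real_derivative u1 x) (at x)" and u2: "\<And>x. (u1 has_real_derivative u2 x) (at x)"
    and u3: "\<And>x. (u2 has_real_derivative u3 x) (at x)" and pos: "u x > 0"
  shows DERIV_powr_1: "((\<lambda>r. u r powr p) has_real_derivative p * u x powr (p - 1) * u1 x) (at x)"
    and DERIV_powr_3: "((deriv ^^ 2) (\<lambda>r. u r powr p) has_real_derivative
      p * (p - 1) * (p - 2) * u x powr (p - 3) * u1 x ^ 3 + 3 * p * (p - 1) * u x powr (p - 2) * u1 x * u2 x
      + p * u x powr (p - 1) * u3 x) (at x)"
proof -
  have "continuous_on UNIV u"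
    using u1 DERIV_isCont continuous_at_imp_continuous_on by blast
  then have op: "open {x. u x > 0}"
    using open_Collect_less[OF continuous_on_const] by blast
  have powr: "((\<lambda>r. u r powr q) has_real_derivative q * u y powr (q - 1) * u1 y) (at y)" if "u y > 0" for q y
    using DERIV_fun_powr[OF u1 that, of q] by simp
  show "((\<lambda>r. u r powr p) has_real_derivative p * u x powr (p - 1) * u1 x) (at x)"
    by (rule powr[OF pos])
  let ?v = "\<lambda>r. u r powr p"
  let ?v1 = "\<lambda>y. p * (u y powr (p - 1) * u1 y)"
  let ?v2 = "\<lambda>y. p * ((p - 1) * (u y powr (p - 2) * (u1 y * u1 y)) + u y powr (p - 1) * u2 y)"
  have v1: "deriv ?v y = ?v1 y" if "u y > 0" for y
    using DERIV_imp_deriv[OF powr[OF that]] by simp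
  have v1': "(?v1 has_real_derivative ?v2 y) (at y)" if "u y > 0" for y
    by (rule DERIV_cong[OF DERIV_cmult[OF DERIV_mult[OF powr[OF that, of "p - 1"] u2]]])
      (simp add: algebra_simps)
  have "(deriv ?v has_real_derivative ?v2 y) (at y)" if "u y > 0" for y
    by (rule has_field_derivative_transform_within_open[OF v1'[OF that] op]) (simp_all add: that v1)
  then have v2: "(deriv ^^ 2) ?v y = ?v2 y" if "u y > 0" for y
    using DERIV_imp_deriv[of "deriv ?v"] that by (simp add: eval_nat_numeral)
  have v2': "(?v2 has_real_derivative p * (p - 1) * (p - 2) * u x powr (p - 3) * u1 x ^ 3
      + 3 * p * (p - 1) * u x powr (p - 2) * u1 x * u2 x + p * u x powr (p - 1) * u3 x) (at x)"
    by (rule DERIV_cong[OF DERIV_cmult[OF DERIV_add[OF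
            DERIV_cmult[OF DERIV_mult[OF powr[OF pos, of "p - 2"] DERIV_mult[OF u2 u2]]]
            DERIV_mult[OF powr[OF pos, of "p - 1"] u3]]]])
      (simp add: algebra_simps power3_eq_cube)
  show "((deriv ^^ 2) ?v has_real_derivative
      p * (p - 1) * (p - 2) * u x powr (p - 3) * u1 x ^ 3 + 3 * p * (p - 1) * u x powr (p - 2) * u1 x * u2 x
      + p * u x powr (p - 1) * u3 x) (at x)"
    by (rule has_field_derivative_transform_within_open[OF v2' op]) (simp_all add: pos v2)
qed

lemma torsion_rhs_const: "torsion_rhs (\<lambda>s. c) s = 0"
proof -
  have "(deriv ^^ 2) (\<lambda>r. c powr (-1/2)) = (\<lambda>s. 0)"
    by (simp add: eval_nat_numeral)
  then show ?thesis
    by (simp add: torsion_rhs_def)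
qed

lemma stationary_solution_const:
  assumes "c > 0"
  shows "stationary_solution torsion_rhs (\<lambda>s. c)"
  using assms by (simp add: stationary_solution_def positive_solution_def smooth_fun_const torsion_rhs_const)

text \<open>For the exponent \<open>p = -1/2\<close> the constants are
  \<open>p * (p - 1) * (p - 2) = -15/8\<close>, \<open>3 * p * (p - 1) = 9/4\<close> and
  \<open>p\<close> itself. Pulling out one \<open>\<epsilon>\<close> prepares the difference
  quotient and leaves positive powers of \<open>\<epsilon>\<close> on the nonlinear terms.\<close>

lemma torsion_rhs_perturbation:
  fixes w :: "real \<Rightarrow> real" and c \<epsilon> s :: real
  assumes w: "smooth_fun w" and pos: "c + \<epsilon> * w s > 0"
  defines "u \<equiv> c + \<epsilon> * w s"
  shows "torsion_rhs (\<lambda>x. c + \<epsilon> * w x) s = \<epsilon> *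
    ((- 1 / 2 * u powr (-3/2) - 3 / 2 * u powr (1/2)) * deriv w s
      + \<epsilon>\<^sup>2 * (- 15 / 8) * u powr (-7/2) * deriv w s ^ 3
      + \<epsilon> * (9 / 4) * u powr (-5/2) * deriv w s * (deriv ^^ 2) w s
      - 1 / 2 * u powr (-3/2) * (deriv ^^ 3) w s)"
proof -
  have d1: "((\<lambda>x. c + \<epsilon> * w x) has_real_derivative \<epsilon> * deriv w x) (at x)" for x
    using smooth_fun_DERIV_0[OF w] by (auto intro!: derivative_eq_intros)
  have d2: "((\<lambda>x. \<epsilon> * deriv w x) has_real_derivative \<epsilon> * (deriv ^^ 2) w x) (at x)" for x
    using DERIV_cmult[OF smooth_fun_DERIV[OF w, of 1]] by (simp add: eval_nat_numeral)
  have d3: "((\<lambda>x. \<epsilon> * (deriv ^^ 2) w x) has_real_derivative \<epsilon> * (deriv ^^ 3) w x) (at x)" for x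
    using DERIV_cmult[OF smooth_fun_DERIV[OF w, of 2]] by (simp add: eval_nat_numeral)
  note D = DERIV_powr_1[OF d1 d2 d3, OF pos] DERIV_powr_3[OF d1 d2 d3, OF pos]
  show ?thesis
    unfolding torsion_rhs_def
    by (rule DERIV_imp_deriv, rule DERIV_cong,
        rule DERIV_add[OF DERIV_diff[OF D(1)[of "-1/2"] D(1)[of "3/2"]] D(2)[of "-1/2"]])
      (simp add: u_def field_simps power2_eq_square power3_eq_cube)
qed

text \<open>The first coefficient is minus the derivative at \<open>c\<close> of the power
  \<open>-1/2\<close> less the power \<open>3/2\<close>; the second is minus the derivative of the
  power \<open>-1/2\<close> alone, the part under two further space derivatives. For fixed
  \<open>s\<close> the perturbed torsion is positive at \<open>s\<close> once
  \<open>\<epsilon>\<close> is small.\<close>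

lemma is_linearization_torsion_rhs:
  assumes "c > 0"
  shows "is_linearization torsion_rhs (\<lambda>s. c)
    (third_order_op (1 / 2 * c powr (-3/2) + 3 / 2 * c powr (1/2)) (1 / 2 * c powr (-3/2)))"
  unfolding is_linearization_def
proof (intro allI impI)
  fix w s
  assume w: "smooth_fun w"
  let ?u = "\<lambda>\<epsilon>. c + \<epsilon> * w s"
  let ?q = "\<lambda>\<epsilon>. (- 1 / 2 * ?u \<epsilon> powr (-3/2) - 3 / 2 * ?u \<epsilon> powr (1/2)) * deriv w s
      + \<epsilon>\<^sup>2 * (- 15 / 8) * ?u \<epsilon> powr (-7/2) * deriv w s ^ 3
      + \<epsilon> * (9 / 4) * ?u \<epsilon> powr (-5/2) * deriv w s * (deriv ^^ 2) w s
      - 1 / 2 * ?u \<epsilon> powr (-3/2) * (deriv ^^ 3) w s"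
  have u: "(?u \<longlongrightarrow> c) (at 0)"
    by (auto intro!: tendsto_eq_intros)
  have powr: "((\<lambda>\<epsilon>. ?u \<epsilon> powr p) \<longlongrightarrow> c powr p) (at 0)" for p
    using assms by (intro tendsto_powr u tendsto_const) auto
  have "(?q \<longlongrightarrow> (- 1 / 2 * c powr (-3/2) - 3 / 2 * c powr (1/2)) * deriv w s
      + 0\<^sup>2 * (- 15 / 8) * c powr (-7/2) * deriv w s ^ 3
      + 0 * (9 / 4) * c powr (-5/2) * deriv w s * (deriv ^^ 2) w s
      - 1 / 2 * c powr (-3/2) * (deriv ^^ 3) w s) (at 0)"
    by (intro tendsto_intros powr)
  then have "(?q \<longlongrightarrow> third_order_op (1 / 2 * c powr (-3/2) + 3 / 2 * c powr (1/2)) (1 / 2 * c powr (-3/2)) w s) (at 0)"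
    by (simp add: third_order_op_def algebra_simps)
  moreover have "\<forall>\<^sub>F \<epsilon> in at 0. ?q \<epsilon> = (torsion_rhs (\<lambda>x. c + \<epsilon> * w x) s - torsion_rhs (\<lambda>s. c) s) / \<epsilon>"
  proof -
    have "\<forall>\<^sub>F \<epsilon> in at 0. ?u \<epsilon> > 0" "\<forall>\<^sub>F \<epsilon> in at 0. \<epsilon> \<noteq> (0 :: real)"
      using order_tendstoD(1)[OF u assms] by (auto simp: eventually_at_filter)
    then show ?thesis
      by eventually_elim (simp add: torsion_rhs_perturbation[OF w] torsion_rhs_const)
  qed
  ultimately show "((\<lambda>\<epsilon>. (torsion_rhs (\<lambda>x. c + \<epsilon> * w x) s - torsion_rhs (\<lambda>s. c) s) / \<epsilon>) \<longlongrightarrow>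
      third_order_op (1 / 2 * c powr (-3/2) + 3 / 2 * c powr (1/2)) (1 / 2 * c powr (-3/2)) w s) (at 0)"
    by (rule Lim_transform_eventually)
qed

theorem theorem7:
  fixes \<tau>0 :: real
  assumes "\<tau>0 > 0"
  shows "stationary_solution torsion_rhs (\<lambda>s. \<tau>0) \<and>
         L2_linearly_stable torsion_rhs (\<lambda>s. \<tau>0)"
  unfolding L2_linearly_stable_def
  using stationary_solution_const[OF assms] is_linearization_torsion_rhs[OF assms]
    L2_stable_zero_third_order_op by blast

end
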